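(* \textsc{MD-RSPP} restricted to instances with target $T\le 1$ can be solved in polynomial time.
   Context: For a digraph $D=(V,E)$, the transitive closure $\mathcal{T}(D)$ is the digraph on $V$ with an edge $(i,j)$ iff $D$ contains a directed $i$-$j$-path. \textsc{MD-RSPP}: input is a digraph $D=(V,E)$, an integer $T\in\mathbb{N}$ (the target), and a set $K\subseteq V\times V$ of commodities $(s,t)$; the question is whether there is a subgraph $H$ of $\mathcal{T}(D)$ of maximum outdegree at most $T$ such that for every $(s,t)\in K$ there is a directed $s$-$t$-path in $H$. *)

theory Defs
  imports "Graph_Theory.Graph_Theory" "HOL-Computational_Algebra.Polynomial"
begin

section \<open>Polynomial-time solvability\<close>

text \<open>
  The machine model is the random access machine with addition and truncated subtraction
  (and no multiplication), read-only input, and unit cost per instruction. Each step adds at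
  most one bit to the largest number among the register contents and the constants of the program,
  so polynomial time on this machine is polynomial time on a Turing machine.

  A program is a list of instructions. A configuration is a program counter together with the
  contents of the registers \<open>R 0, R 1, \<dots>\<close>.
\<close>

datatype ram_instr =
    Const nat nat     \<comment> \<open>\<open>Const d k\<close>: \<open>R d := k\<close>\<close>
  | Move nat nat      \<comment> \<open>\<open>Move d a\<close>: \<open>R d := R a\<close>\<close>
  | Add nat nat nat   \<comment> \<open>\<open>Add d a b\<close>: \<open>R d := R a + R b\<close>\<close>
  | Sub nat nat nat   \<comment> \<open>\<open>Sub d a b\<close>: \<open>R d := max 0 (R a - R b)\<close>\<close>
  | Load nat nat      \<comment> \<open>\<open>Load d a\<close>: \<open>R d := R (R a)\<close>\<close>
  | Store nat nat     \<comment> \<open>\<open>Store a b\<close>: \<open>R (R a) := R b\<close>\<close>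
  | Read nat nat      \<comment> \<open>\<open>Read d a\<close>: \<open>R d := \<close> input bit number \<open>R a\<close>; \<open>0\<close> past the end\<close>
  | Jump nat
  | Jzero nat nat     \<comment> \<open>\<open>Jzero a l\<close>: go to \<open>l\<close> if \<open>R a = 0\<close>\<close>

type_synonym ram_config = "nat \<times> (nat \<Rightarrow> nat)"

fun ram_exec :: "bool list \<Rightarrow> ram_instr \<Rightarrow> ram_config \<Rightarrow> ram_config" where
  "ram_exec x (Const d k) (pc, R) = (Suc pc, R(d := k))"
| "ram_exec x (Move d a) (pc, R) = (Suc pc, R(d := R a))"
| "ram_exec x (Add d a b) (pc, R) = (Suc pc, R(d := R a + R b))"
| "ram_exec x (Sub d a b) (pc, R) = (Suc pc, R(d := R a - R b))"
| "ram_exec x (Load d a) (pc, R) = (Suc pc, R(d := R (R a)))"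
| "ram_exec x (Store a b) (pc, R) = (Suc pc, R(R a := R b))"
| "ram_exec x (Read d a) (pc, R) =
     (Suc pc, R(d := (if R a < length x then of_bool (x ! R a) else 0)))"
| "ram_exec x (Jump l) (pc, R) = (l, R)"
| "ram_exec x (Jzero a l) (pc, R) = (if R a = 0 then l else Suc pc, R)"

definition ram_halted :: "ram_instr list \<Rightarrow> ram_config \<Rightarrow> bool" where
  "ram_halted P c \<longleftrightarrow> length P \<le> fst c"

definition ram_step :: "ram_instr list \<Rightarrow> bool list \<Rightarrow> ram_config \<Rightarrow> ram_config" where
  "ram_step P x c = (if ram_halted P c then c else ram_exec x (P ! fst c) c)"

text \<open>Initially \<open>R 0\<close> holds the length of the input and all other registers are \<open>0\<close>.\<close>

definition ram_init :: "bool list \<Rightarrow> ram_config" where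
  "ram_init x = (0, (\<lambda>_. 0)(0 := length x))"

text \<open>
  The answer is in \<open>R 0\<close>. Halted configurations are fixed points of \<open>ram_step\<close>, so halting
  within \<open>t\<close> steps is the same as being halted after \<open>t\<close> applications of it.
\<close>

definition ram_answers_within :: "ram_instr list \<Rightarrow> bool list \<Rightarrow> nat \<Rightarrow> bool \<Rightarrow> bool" where
  "ram_answers_within P x t b \<longleftrightarrow>
     (let c = (ram_step P x ^^ t) (ram_init x) in ram_halted P c \<and> snd c 0 = of_bool b)"

text \<open>
  A decision problem is given by a set of instances, their encoding as bit strings, and the
  question. Nothing is required of the program on strings that encode no instance.
\<close>

definition solvable_in_poly_time ::
    "'i set \<Rightarrow> ('i \<Rightarrow> bool list) \<Rightarrow> ('i \<Rightarrow> bool) \<Rightarrow> bool" where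
  "solvable_in_poly_time I enc yes \<longleftrightarrow>
     (\<exists>(P :: ram_instr list) (p :: nat poly).
        \<forall>i\<in>I. ram_answers_within P (enc i) (poly p (length (enc i))) (yes i))"


section \<open>The problem MD-RSPP\<close>

text \<open>
  As the one-vertex path is a path, the closure has a loop at every vertex. These loops are of no
  use to a subgraph of small outdegree, and a commodity \<open>(s, s)\<close> is served by the trivial path.
\<close>

definition transitive_closure :: "'a pair_pre_digraph \<Rightarrow> 'a pair_pre_digraph" where
  "transitive_closure D =
     \<lparr> pverts = pverts D, parcs = {(i, j). \<exists>p. pre_digraph.apath (with_proj D) i p j} \<rparr>"

type_synonym 'a md_rspp = "'a pair_pre_digraph \<times> nat \<times> ('a \<times> 'a) set"

fun md_rspp_instance :: "'a md_rspp \<Rightarrow> bool" where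
  "md_rspp_instance (D, T, K) \<longleftrightarrow> pair_fin_digraph D \<and> K \<subseteq> pverts D \<times> pverts D"

fun md_rspp :: "'a md_rspp \<Rightarrow> bool" where
  "md_rspp (D, T, K) \<longleftrightarrow>
     (\<exists>H :: 'a pair_pre_digraph.
        subgraph (with_proj H) (with_proj (transitive_closure D)) \<and>
        (\<forall>v\<in>pverts H. out_degree (with_proj H) v \<le> T) \<and>
        (\<forall>(s, t)\<in>K. \<exists>p. pre_digraph.apath (with_proj H) s p t))"

fun target :: "'a md_rspp \<Rightarrow> nat" where
  "target (D, T, K) = T"

text \<open>
  For the encoding, the vertices are numbered \<open>0, \<dots>, n - 1\<close>. An instance is encoded as
  \<open>n\<close> in unary, the adjacency matrices of \<open>E\<close> and of \<open>K\<close>, and \<open>T\<close> in binary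
  (least significant bit first, up to the end of the string).
\<close>

definition numbered :: "nat md_rspp \<Rightarrow> bool" where
  "numbered i \<longleftrightarrow> (\<exists>n. pverts (fst i) = {..<n})"

definition adjacency_bits :: "nat \<Rightarrow> (nat \<times> nat) set \<Rightarrow> bool list" where
  "adjacency_bits n R = map (\<lambda>e. e \<in> R) (List.product [0..<n] [0..<n])"

fun binary :: "nat \<Rightarrow> bool list" where
  "binary k = (if k = 0 then [] else odd k # binary (k div 2))"

declare binary.simps [simp del]

fun encode_md_rspp :: "nat md_rspp \<Rightarrow> bool list" where
  "encode_md_rspp (D, T, K) =
     (let n = card (pverts D) in
        replicate n True @ [False] @ adjacency_bits n (parcs D) @ adjacency_bits n K @ binary T)"

end

theory Submission
  imports Defs
begin

text \<open>
  Let \<open>R\<close> be the reachability preorder of \<open>D\<close>. With outdegree at most \<open>1\<close>, the graph \<open>H\<close> is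
  functional, so each of its components is an in-tree, possibly with its root replaced by a cycle.
  In a component \<open>C\<close> of the graph of commodities the vertices that all of \<open>C\<close> reaches under \<open>R\<close> may all
  be put on that cycle. The other vertices must form a forest, which a greedy algorithm finds: a vertex
  without outgoing commodity that is reached by all of its component can be made the root of that
  component, and then be deleted. This cannot go wrong, because every nonempty set of vertices off the
  cycles has such a root as soon as a solution exists: take a maximal vertex of a component with
  respect to reachability in \<open>H\<close>.

  To run the algorithm on the machine, it is written as a sequence of assignments of first-order
  definable relations and of loops whose length is that of the input, so that the time bound
  can be read off the syntax.
\<close>

section \<open>The greedy algorithm\<close>

text \<open>The cycles need not be guessed. In a functional graph that serves the commodities, a
  vertex on a cycle is reached by its whole component of commodities, so it lies in
  \<open>top_set\<close>; and a commodity that starts in \<open>top_set\<close> also ends there,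
  because commodities must be reachable pairs. Hence \<open>top_set\<close> is settled once, before
  the greedy phase, and never revised. In the greedy phase, deletions only shrink components and the
  sets of outgoing commodities, so a removable vertex stays removable. The order of deletions is
  irrelevant, and one round can delete all removable vertices simultaneously, which makes a round
  definable by a formula. This suffices because the two matrices make \<open>L\<close> at least the
  number of vertices, the number of arcs and twice the number of commodities: these bound the rounds
  of deletion, the closure of the arcs and the closure of the symmetrised commodities.\<close>

definition conn :: "'a rel \<Rightarrow> 'a set \<Rightarrow> 'a rel" where
  "conn K A = ((K \<union> K\<inverse>) \<inter> A \<times> A)\<^sup>*"

definition top_set :: "'a rel \<Rightarrow> 'a rel \<Rightarrow> 'a set \<Rightarrow> 'a set" where
  "top_set R K A = {x\<in>A. \<forall>u. (u, x) \<in> conn K A \<longrightarrow> (u, x) \<in> R}"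

text \<open>The exception \<open>w = x\<close> is there because a commodity \<open>(x, x)\<close> is
  served by the trivial path.\<close>

definition removable :: "'a rel \<Rightarrow> 'a rel \<Rightarrow> 'a set \<Rightarrow> 'a set" where
  "removable R K A = {x \<in> top_set R K A. \<forall>w\<in>A. (x, w) \<in> K \<longrightarrow> w = x}"

lemma conn_mono: "A \<subseteq> B \<Longrightarrow> conn K A \<subseteq> conn K B"
  unfolding conn_def by (rule rtrancl_mono) auto

lemma conn_refl: "(x, x) \<in> conn K A"
  by (simp add: conn_def)

lemma conn_trans: "(x, y) \<in> conn K A \<Longrightarrow> (y, z) \<in> conn K A \<Longrightarrow> (x, z) \<in> conn K A"
  unfolding conn_def by (rule rtrancl_trans)

lemma conn_sym: "(x, y) \<in> conn K A \<Longrightarrow> (y, x) \<in> conn K A"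
proof -
  have "sym ((K \<union> K\<inverse>) \<inter> A \<times> A)" by (auto simp: sym_def)
  then show "(x, y) \<in> conn K A \<Longrightarrow> (y, x) \<in> conn K A"
    unfolding conn_def by (metis sym_rtrancl symD)
qed

lemma conn_arc: "(x, y) \<in> K \<Longrightarrow> x \<in> A \<Longrightarrow> y \<in> A \<Longrightarrow> (x, y) \<in> conn K A"
  unfolding conn_def by auto

text \<open>\<open>conn K A\<close> is an equivalence on the whole type in which everything outside
  \<open>A\<close> is isolated: a nontrivial chain stays inside \<open>A\<close>.\<close>

lemma conn_in: "(x, y) \<in> conn K A \<Longrightarrow> y \<in> A \<Longrightarrow> x \<in> A"
  unfolding conn_def by (cases rule: converse_rtranclE) auto

text \<open>Both conditions are universal, over a component and over outgoing commodities, and both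
  ranges shrink with the set.\<close>

lemma removable_mono: "B \<subseteq> A \<Longrightarrow> x \<in> B \<Longrightarrow> x \<in> removable R K A \<Longrightarrow> x \<in> removable R K B"
  using conn_mono[of B A K] unfolding removable_def top_set_def by auto

section \<open>Forests serving the commodities off the cycles\<close>

text \<open>Arcs stay inside a component, so that the root above a vertex belongs to the component
  of that vertex. The last conjunct plays the part of acyclicity: every vertex leads to a root,
  where an outgoing arc can still be added.\<close>

definition has_forest :: "'a rel \<Rightarrow> 'a rel \<Rightarrow> 'a set \<Rightarrow> bool" where
  "has_forest R K A \<longleftrightarrow>
     (\<exists>F. single_valued F \<and> F \<subseteq> R \<inter> conn K A \<inter> A \<times> A \<and> K \<inter> A \<times> A \<subseteq> F\<^sup>* \<and>
          (\<forall>x. \<exists>z. (x, z) \<in> F\<^sup>* \<and> z \<notin> Domain F))"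

lemma has_forest_empty: "has_forest R K {}"
  unfolding has_forest_def by (rule exI[of _ "{}"]) (auto simp: single_valued_def)

text \<open>\<open>r\<close> becomes the parent of all roots in its component of \<open>A\<close>,
  which may have fallen apart without \<open>r\<close>. A commodity into \<open>r\<close> then runs
  through the root above its source, and a commodity out of \<open>r\<close> within \<open>A\<close>
  can only be \<open>(r, r)\<close>.\<close>

lemma has_forest_remove1:
  assumes r: "r \<in> removable R K A" and "has_forest R K (A - {r})"
  shows "has_forest R K A"
proof -
  let ?B = "A - {r}"
  obtain F where sv: "single_valued F" and F: "F \<subseteq> R \<inter> conn K ?B \<inter> ?B \<times> ?B"
    and K: "K \<inter> ?B \<times> ?B \<subseteq> F\<^sup>*" and root: "\<And>x. \<exists>z. (x, z) \<in> F\<^sup>* \<and> z \<notin> Domain F"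
    using assms(2) unfolding has_forest_def by blast
  define F' where "F' = F \<union> {(z, r) |z. z \<in> ?B \<and> z \<notin> Domain F \<and> (z, r) \<in> conn K A}"
  have rA: "r \<in> A" and rR: "\<And>u. (u, r) \<in> conn K A \<Longrightarrow> (u, r) \<in> R"
    and rK: "\<And>w. w \<in> A \<Longrightarrow> (r, w) \<in> K \<Longrightarrow> w = r"
    using r unfolding removable_def top_set_def by auto
  have cB: "conn K ?B \<subseteq> conn K A" by (rule conn_mono) auto
  have Fc: "F\<^sup>* \<subseteq> conn K A"
    using F cB unfolding conn_def by (metis (no_types, lifting) le_inf_iff order_trans rtrancl_mono rtrancl_idemp)
  have sub: "F\<^sup>* \<subseteq> F'\<^sup>*" by (rule rtrancl_mono) (auto simp: F'_def)
  have rD: "r \<notin> Domain F'" using F by (auto simp: F'_def)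
  have sv': "single_valued F'" using sv unfolding F'_def single_valued_def by blast
  moreover have "F' \<subseteq> R \<inter> conn K A \<inter> A \<times> A"
    using F cB rA rR unfolding F'_def by auto
  moreover have "K \<inter> A \<times> A \<subseteq> F'\<^sup>*"
  proof safe
    fix s t assume st: "(s, t) \<in> K" "s \<in> A" "t \<in> A"
    consider "s = r" | "s \<noteq> r" "t = r" | "s \<noteq> r" "t \<noteq> r" by blast
    then show "(s, t) \<in> F'\<^sup>*"
    proof cases
      case 1 then show ?thesis using rK st by auto
    next
      case 2
      obtain z where z: "(s, z) \<in> F\<^sup>*" "z \<notin> Domain F" using root by blast
      have "(z, r) \<in> conn K A"
        using z(1) Fc st 2 conn_arc[of s t K A] by (meson conn_sym conn_trans subsetD)
      moreover have "z \<in> ?B"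
        using z(1) F st 2 by (cases rule: rtranclE) auto
      ultimately have "(z, r) \<in> F'" using z by (auto simp: F'_def)
      then show ?thesis using z sub 2 by (meson rtrancl.rtrancl_into_rtrancl subsetD)
    next
      case 3 then show ?thesis using K st sub by auto
    qed
  qed
  moreover have "\<exists>z. (x, z) \<in> F'\<^sup>* \<and> z \<notin> Domain F'" for x
  proof -
    obtain z where z: "(x, z) \<in> F\<^sup>*" "z \<notin> Domain F" using root by blast
    show ?thesis
    proof (cases "z \<in> Domain F'")
      case True
      then have "(z, r) \<in> F'" using z by (auto simp: F'_def)
      then show ?thesis using z sub rD by (meson rtrancl.rtrancl_into_rtrancl subsetD)
    next
      case False then show ?thesis using z sub by auto
    qed
  qed
  ultimately show ?thesis unfolding has_forest_def by blast
qed

text \<open>The vertices of \<open>B\<close> are put back one at a time; by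
  \<open>removable_mono\<close> each is still removable while others are missing.\<close>

lemma has_forest_remove:
  assumes "finite B" "B \<subseteq> removable R K A" "has_forest R K (A - B)"
  shows "has_forest R K A"
  using assms
proof (induction B rule: finite_induct)
  case (insert b B)
  have "b \<in> removable R K (A - B)"
    using insert by (intro removable_mono[of "A - B" A]) (auto simp: removable_def top_set_def)
  moreover have "A - B - {b} = A - insert b B" by auto
  ultimately show ?case using insert has_forest_remove1[of b R K "A - B"] by simp
qed simp

section \<open>Completing a forest to a routing\<close>

text \<open>Every class of \<open>Q\<close> in \<open>S\<close> gets one cycle. The clause on
  \<open>Domain G\<close> serves the induction: it supplies an arc of the cycle into which a new
  element of the class is spliced. The first element of a class gets a loop.\<close>

lemma cycles_on_classes:
  assumes "finite S" "sym Q" "trans Q"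
  shows "\<exists>G. single_valued G \<and> G \<subseteq> Q \<inter> S \<times> S \<and> (\<forall>x\<in>S. (x, x) \<in> Q \<longrightarrow> x \<in> Domain G) \<and>
           Q \<inter> S \<times> S \<subseteq> G\<^sup>*"
  using assms(1)
proof (induction S rule: finite_induct)
  case empty
  show ?case by (rule exI[of _ "{}"]) (auto simp: single_valued_def)
next
  case (insert x S)
  then obtain G where sv: "single_valued G" and G: "G \<subseteq> Q \<inter> S \<times> S"
    and dom: "\<forall>x\<in>S. (x, x) \<in> Q \<longrightarrow> x \<in> Domain G" and con: "Q \<inter> S \<times> S \<subseteq> G\<^sup>*" by blast
  have Qs: "(a, b) \<in> Q \<Longrightarrow> (b, a) \<in> Q" for a b using assms(2) by (auto dest: symD)
  have Qt: "(a, b) \<in> Q \<Longrightarrow> (b, c) \<in> Q \<Longrightarrow> (a, c) \<in> Q" for a b c using assms(3) by (auto dest: transD)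
  show ?case
  proof (cases "\<exists>a\<in>S. (a, x) \<in> Q")
    case True
    then obtain a where a: "a \<in> S" "(a, x) \<in> Q" by blast
    then have "a \<in> Domain G" using dom Qs Qt by blast
    then obtain b where ab: "(a, b) \<in> G" by blast
    have b: "b \<in> S" "(a, b) \<in> Q" using ab G by auto
    define G' where "G' = (G - {(a, b)}) \<union> {(a, x), (x, b)}"
    have "(a, b) \<in> G'\<^sup>*" unfolding G'_def by (meson UnI2 converse_rtrancl_into_rtrancl insertI1 insertI2 r_into_rtrancl)
    then have "G \<subseteq> G'\<^sup>*" unfolding G'_def by auto
    then have sub: "G\<^sup>* \<subseteq> G'\<^sup>*" by (metis rtrancl_mono rtrancl_idemp)
    have "single_valued G'" using sv G ab insert(2) unfolding G'_def single_valued_def by blast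
    moreover have "G' \<subseteq> Q \<inter> insert x S \<times> insert x S"
      using G a b Qs[OF a(2)] Qt unfolding G'_def by blast
    moreover have "\<forall>y\<in>insert x S. (y, y) \<in> Q \<longrightarrow> y \<in> Domain G'"
      using dom unfolding G'_def by blast
    moreover have "Q \<inter> insert x S \<times> insert x S \<subseteq> G'\<^sup>*"
    proof (rule subrelI)
      fix s t assume "(s, t) \<in> Q \<inter> insert x S \<times> insert x S"
      then have st: "(s, t) \<in> Q" "s \<in> insert x S" "t \<in> insert x S" by auto
      have 1: "(s, x) \<in> G'\<^sup>*" if "s \<in> S" "(s, x) \<in> Q" for s
      proof -
        have "(s, a) \<in> Q" using Qt[OF that(2) Qs[OF a(2)]] .
        then have "(s, a) \<in> G'\<^sup>*" using that(1) a(1) con sub by auto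
        then show ?thesis unfolding G'_def by (auto intro: rtrancl.rtrancl_into_rtrancl)
      qed
      have 2: "(x, t) \<in> G'\<^sup>*" if "t \<in> S" "(x, t) \<in> Q" for t
      proof -
        have "(b, t) \<in> Q" using Qt[OF Qs[OF b(2)] Qt[OF a(2) that(2)]] .
        then have "(b, t) \<in> G'\<^sup>*" using that(1) b(1) con sub by auto
        then show ?thesis unfolding G'_def by (auto intro: converse_rtrancl_into_rtrancl)
      qed
      show "(s, t) \<in> G'\<^sup>*" using st 1 2 con sub by auto
    qed
    ultimately show ?thesis by blast
  next
    case False
    define G' where "G' = G \<union> ({(x, x)} \<inter> Q)"
    have sub: "G\<^sup>* \<subseteq> G'\<^sup>*" unfolding G'_def by (rule rtrancl_mono) auto
    have "single_valued G'" using sv G insert(2) unfolding G'_def single_valued_def by blast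
    moreover have "G' \<subseteq> Q \<inter> insert x S \<times> insert x S" using G unfolding G'_def by auto
    moreover have "\<forall>y\<in>insert x S. (y, y) \<in> Q \<longrightarrow> y \<in> Domain G'"
      using dom unfolding G'_def by blast
    moreover have "Q \<inter> insert x S \<times> insert x S \<subseteq> G'\<^sup>*"
      using con sub False Qs by blast
    ultimately show ?thesis by blast
  qed
qed

text \<open>Three relations with disjoint domains are united: the forest \<open>F\<close>, the
  cycles \<open>G\<close> on the top set, and \<open>H\<close>, which leads from each forest root to
  the cycle of its component, if there is one.\<close>

lemma forest_imp_routing:
  assumes fin: "finite U" and KU: "K \<subseteq> U \<times> U" and KR: "K \<subseteq> R" and tr: "trans R"
    and forest: "has_forest R K (U - top_set R K U)"
  shows "\<exists>F. single_valued F \<and> F \<subseteq> R \<inter> U \<times> U \<and> K \<subseteq> F\<^sup>*"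
proof -
  let ?M = "top_set R K U"
  let ?B = "U - ?M"
  have MR: "(u, m) \<in> R" if "m \<in> ?M" "(u, m) \<in> conn K U" for u m
    using that by (auto simp: top_set_def)
  have MU: "?M \<subseteq> U" by (auto simp: top_set_def)
  have "sym (conn K U)" "trans (conn K U)"
    by (auto intro: symI transI dest: conn_sym conn_trans)
  moreover have "finite ?M" using fin MU finite_subset by blast
  ultimately obtain G where svG: "single_valued G" and G: "G \<subseteq> conn K U \<inter> ?M \<times> ?M"
    and conG: "conn K U \<inter> ?M \<times> ?M \<subseteq> G\<^sup>*" using cycles_on_classes[of ?M "conn K U"] by blast
  obtain F where svF: "single_valued F" and F: "F \<subseteq> R \<inter> conn K ?B \<inter> ?B \<times> ?B"
    and KF: "K \<inter> ?B \<times> ?B \<subseteq> F\<^sup>*" and root: "\<And>x. \<exists>z. (x, z) \<in> F\<^sup>* \<and> z \<notin> Domain F"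
    using forest unfolding has_forest_def by blast
  \<comment> \<open>Any entry point will do, since the cycle leads from it to all top vertices of
    the component.\<close>
  define mu where "mu z = (SOME m. m \<in> ?M \<and> (z, m) \<in> conn K U)" for z
  have mu: "mu z \<in> ?M \<and> (z, mu z) \<in> conn K U" if "m \<in> ?M" "(z, m) \<in> conn K U" for z m
    unfolding mu_def by (rule someI[of _ m]) (use that in auto)
  define H where "H = {(z, mu z) |z. z \<in> ?B \<and> z \<notin> Domain F \<and> (\<exists>m\<in>?M. (z, m) \<in> conn K U)}"
  define F' where "F' = F \<union> G \<union> H"
  have cB: "conn K ?B \<subseteq> conn K U" by (rule conn_mono) auto
  have Fc: "F\<^sup>* \<subseteq> conn K U"
    using F cB unfolding conn_def by (metis (no_types, lifting) le_inf_iff order_trans rtrancl_mono rtrancl_idemp)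
  have subF: "F\<^sup>* \<subseteq> F'\<^sup>*" and subG: "G\<^sup>* \<subseteq> F'\<^sup>*" using rtrancl_mono[of F "F \<union> G \<union> H"] rtrancl_mono[of G "F \<union> G \<union> H"] unfolding F'_def by blast+
  have "single_valued H" by (auto simp: H_def single_valued_def)
  moreover have "Domain F \<inter> Domain G = {}" "Domain F \<inter> Domain H = {}" "Domain G \<inter> Domain H = {}"
    using F G by (auto simp: H_def)
  ultimately have "single_valued F'"
    using svF svG unfolding F'_def single_valued_def by blast
  moreover have "F' \<subseteq> R \<inter> U \<times> U"
    using F G mu MR MU unfolding F'_def H_def by blast
  moreover have "K \<subseteq> F'\<^sup>*"
  proof safe
    fix s t assume st: "(s, t) \<in> K"
    have stU: "s \<in> U" "t \<in> U" using st KU by auto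
    have c: "(s, t) \<in> conn K U" using conn_arc[OF st stU] .
    consider "s \<in> ?M" | "s \<notin> ?M" "t \<in> ?M" | "s \<notin> ?M" "t \<notin> ?M" by blast
    then show "(s, t) \<in> F'\<^sup>*"
    proof cases
      case 1
      \<comment> \<open>No commodity leaves the top set: whatever reaches \<open>s\<close> also
        reaches \<open>t\<close>, as \<open>(s, t)\<close> is in \<open>R\<close>.\<close>
      have "t \<in> ?M"
      proof -
        have "(u, t) \<in> R" if "(u, t) \<in> conn K U" for u
        proof -
          have "(u, s) \<in> R" using MR[OF 1] that c conn_sym conn_trans by metis
          then show ?thesis using st KR tr by (auto dest: transD)
        qed
        then show ?thesis using stU by (auto simp: top_set_def)
      qed
      then show ?thesis using 1 c conG subG by blast
    next
      case 2
      obtain z where z: "(s, z) \<in> F\<^sup>*" "z \<notin> Domain F" using root by blast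
      have zt: "(z, t) \<in> conn K U" using z(1) Fc c by (meson conn_sym conn_trans subsetD)
      have "z \<in> ?B" using z(1) F stU 2 by (cases rule: rtranclE) auto
      then have "(z, mu z) \<in> F'" using z zt 2 by (auto simp: F'_def H_def)
      moreover have "(mu z, t) \<in> F'\<^sup>*"
        using mu[OF 2(2) zt] zt 2(2) conG subG by (meson IntI SigmaI conn_sym conn_trans subsetD)
      ultimately show ?thesis using z subF
        by (meson converse_rtrancl_into_rtrancl rtrancl_trans subsetD)
    next
      case 3 then show ?thesis using st stU KF subF by blast
    qed
  qed
  ultimately show ?thesis by blast
qed

section \<open>A routing guarantees a removable vertex\<close>

text \<open>From a vertex of a cycle, a functional graph can only walk around that cycle.\<close>

lemma single_valued_cycle_back:
  assumes sv: "single_valued F" and cyc: "(r, r) \<in> F\<^sup>+" and "(r, u) \<in> F\<^sup>*"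
  shows "(u, r) \<in> F\<^sup>*"
  using assms(3)
proof (induction rule: rtrancl_induct)
  case (step y z)
  have "(y, r) \<in> F\<^sup>+"
    using step cyc by (metis rtranclD)
  then obtain c where "(y, c) \<in> F" "(c, r) \<in> F\<^sup>*" by (meson tranclD)
  then show ?case using step sv by (auto dest: single_valuedD)
qed simp

text \<open>Take \<open>r\<close> reaching the fewest elements of \<open>C\<close>. What it reaches
  has a smaller reach set, hence the same one, which contains \<open>r\<close>.\<close>

lemma exists_maximal:
  assumes "finite C" "c \<in> C"
  shows "\<exists>r\<in>C. \<forall>u\<in>C. (r, u) \<in> F\<^sup>* \<longrightarrow> (u, r) \<in> F\<^sup>*"
proof -
  let ?f = "\<lambda>r. card {u\<in>C. (r, u) \<in> F\<^sup>*}"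
  obtain r where r: "r \<in> C" "\<And>u. u \<in> C \<Longrightarrow> ?f r \<le> ?f u"
    using arg_min_least[of C _ ?f] arg_min_if_finite(1)[of C ?f] assms by blast
  have "(u, r) \<in> F\<^sup>*" if u: "u \<in> C" "(r, u) \<in> F\<^sup>*" for u
  proof -
    have "{v\<in>C. (u, v) \<in> F\<^sup>*} \<subseteq> {v\<in>C. (r, v) \<in> F\<^sup>*}" using u by auto
    then have "{v\<in>C. (u, v) \<in> F\<^sup>*} = {v\<in>C. (r, v) \<in> F\<^sup>*}"
      using r(2)[OF u(1)] assms(1) by (intro card_seteq) auto
    then show ?thesis using r(1) by auto
  qed
  then show ?thesis using r by auto
qed

lemma rtrancl_refl_trans:
  assumes "refl R" "trans R"
  shows "R\<^sup>* = R"
proof -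
  have "R\<^sup>= = R" using assms(1) by (auto simp: refl_on_def)
  then show ?thesis using trancl_id[OF assms(2)] rtrancl_trancl_reflcl[of R] by simp
qed

text \<open>Let \<open>r\<close> be maximal in a component on \<open>A\<close>. A commodity from
  \<open>r\<close> to another vertex of \<open>A\<close> would close a cycle through
  \<open>r\<close>, which would put \<open>r\<close> into the top set that \<open>A\<close> avoids.
  Paths of \<open>F\<close> may leave \<open>A\<close>; only their ends matter.\<close>

lemma routing_imp_removable:
  assumes fin: "finite U" and R: "refl R" "trans R"
    and sv: "single_valued F" and FR: "F \<subseteq> R" and KF: "K \<subseteq> F\<^sup>*"
    and A: "A \<subseteq> U - top_set R K U" "a \<in> A"
  shows "removable R K A \<noteq> {}"
proof -
  have FR': "F\<^sup>* \<subseteq> R"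
    using rtrancl_mono[OF FR] rtrancl_refl_trans[OF R] by simp
  define C where "C = {u. (u, a) \<in> conn K A}"
  have CA: "C \<subseteq> A" using A conn_in unfolding C_def by fast
  then have "finite C" using A fin by (meson Diff_subset finite_subset)
  moreover have "a \<in> C" by (simp add: C_def conn_refl)
  ultimately obtain r where r: "r \<in> C" and rmax: "\<And>u. u \<in> C \<Longrightarrow> (r, u) \<in> F\<^sup>* \<Longrightarrow> (u, r) \<in> F\<^sup>*"
    using exists_maximal[of C a F] by blast
  \<comment> \<open>Induction along the chain of commodities. Where a commodity points away from
    \<open>r\<close>, its source reaches both its end and \<open>r\<close>, so these two are
    comparable in the functional \<open>F\<close>, and \<open>ret\<close> repairs the wrong order.
    It is used with \<open>B = A\<close>, where maximality gives \<open>ret\<close>, and with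
    \<open>B = U\<close>, where a cycle through \<open>r\<close> gives it.\<close>
  have reach: "(u, r) \<in> F\<^sup>*"
    if "(u, r) \<in> conn K B" and ret: "\<And>u. (u, r) \<in> conn K B \<Longrightarrow> (r, u) \<in> F\<^sup>* \<Longrightarrow> (u, r) \<in> F\<^sup>*" for u B
    using that(1) unfolding conn_def
  proof (induction rule: converse_rtrancl_induct)
    case (step u' u)
    have c: "(u', r) \<in> conn K B" using step(1,2) unfolding conn_def by (rule converse_rtrancl_into_rtrancl)
    show ?case
    proof (cases "(u', u) \<in> K")
      case True
      then show ?thesis using step KF by (meson rtrancl_trans subsetD)
    next
      case False
      then have "(u, u') \<in> F\<^sup>*" using step KF by auto
      then have "(u', r) \<in> F\<^sup>* \<or> (r, u') \<in> F\<^sup>*" using single_valued_confluent[OF sv] step by blast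
      then show ?thesis using ret c by blast
    qed
  qed simp
  have toC: "u \<in> C" if "(u, r) \<in> conn K A" for u
    using that r unfolding C_def by (auto intro: conn_trans)
  have all: "(u, r) \<in> F\<^sup>*" if "(u, r) \<in> conn K A" for u
    by (rule reach[OF that]) (use toC rmax in blast)
  have "w = r" if w: "w \<in> A" "(r, w) \<in> K" for w
  proof (rule ccontr)
    assume ne: "w \<noteq> r"
    have "(w, r) \<in> conn K A" using w r CA conn_arc by (metis conn_sym subsetD)
    then have "(w, r) \<in> F\<^sup>*" by (rule all)
    moreover have "(r, w) \<in> F\<^sup>+" using w KF ne by (metis rtranclD subsetD)
    ultimately have "(r, r) \<in> F\<^sup>+" by simp
    then have "(u, r) \<in> F\<^sup>*" if "(u, r) \<in> conn K U" for u
      using reach[OF that] single_valued_cycle_back[OF sv] by blast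
    then have "r \<in> top_set R K U" using FR' r CA A unfolding top_set_def by blast
    then show False using r CA A by blast
  qed
  then have "r \<in> removable R K A" using all FR' r CA unfolding removable_def top_set_def by blast
  then show ?thesis by blast
qed

section \<open>Rounds of simultaneous deletion\<close>

definition prune :: "'a rel \<Rightarrow> 'a rel \<Rightarrow> 'a set \<Rightarrow> 'a set" where
  "prune R K A = A - removable R K A"

lemma prune_pow_forest:
  assumes "finite A" "(prune R K ^^ k) A = {}"
  shows "has_forest R K A"
  using assms
proof (induction k arbitrary: A)
  case (Suc k)
  have "has_forest R K (prune R K A)"
    proof (rule Suc.IH)
    show "finite (prune R K A)" using Suc.prems by (simp add: prune_def)
    show "(prune R K ^^ k) (prune R K A) = {}"
      using Suc.prems by (simp add: funpow_Suc_right del: funpow.simps)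
  qed
  moreover have "finite (removable R K A)"
    using Suc(2) by (auto simp: removable_def top_set_def)
  ultimately show ?case using has_forest_remove[of "removable R K A" R K A] by (simp add: prune_def)
qed (simp add: has_forest_empty)

text \<open>Every round on a nonempty set deletes something, and surplus rounds do not change the
  empty set; so any upper bound for \<open>card A\<close> may serve as \<open>k\<close>.\<close>

lemma prune_pow_empty:
  assumes "finite A" and "\<And>B. B \<subseteq> A \<Longrightarrow> B \<noteq> {} \<Longrightarrow> removable R K B \<noteq> {}" and "card A \<le> k"
  shows "(prune R K ^^ k) A = {}"
  using assms
proof (induction k arbitrary: A)
  case (Suc k)
  have rem: "removable R K A \<subseteq> A" by (auto simp: removable_def top_set_def)
  show ?case
  proof (cases "A = {}")
    case True
    have "prune R K {} = {}" by (simp add: prune_def)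
    then have "(prune R K ^^ m) {} = {}" for m by (induction m) auto
    then show ?thesis using True by blast
  next
    case False
    then have "prune R K A \<subset> A" using Suc(3)[of A] rem by (auto simp: prune_def)
    then have "card (prune R K A) < card A" using Suc(2) by (simp add: psubset_card_mono)
    then have "(prune R K ^^ k) (prune R K A) = {}"
      using Suc(2-4) rem by (intro Suc.IH) (auto simp: prune_def)
    then show ?thesis by (simp add: funpow_Suc_right del: funpow.simps)
  qed
qed simp

text \<open>\<open>U\<close> and \<open>k\<close> are left open so that the program may take all
  numbers below the input length for \<open>U\<close> and the input length for
  \<open>k\<close>.\<close>

lemma routing_iff_prune:
  assumes fin: "finite U" and KU: "K \<subseteq> U \<times> U" and R: "refl R" "trans R" and k: "card U \<le> k"
  shows "(\<exists>F. single_valued F \<and> F \<subseteq> R \<and> K \<subseteq> F\<^sup>*) \<longleftrightarrow>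
         K \<subseteq> R \<and> (prune R K ^^ k) (U - top_set R K U) = {}"
proof (intro iffI conjI)
  assume "\<exists>F. single_valued F \<and> F \<subseteq> R \<and> K \<subseteq> F\<^sup>*"
  then obtain F where F: "single_valued F" "F \<subseteq> R" "K \<subseteq> F\<^sup>*" by blast
  have "F\<^sup>* \<subseteq> R\<^sup>*" using F(2) by (rule rtrancl_mono)
  also have "\<dots> = R" using R by (rule rtrancl_refl_trans)
  finally show "K \<subseteq> R" using F by blast
  show "(prune R K ^^ k) (U - top_set R K U) = {}"
  proof (rule prune_pow_empty)
    show "card (U - top_set R K U) \<le> k" using fin k by (meson Diff_subset card_mono le_trans)
  qed (use fin routing_imp_removable[OF fin R F] in auto)
next
  assume "K \<subseteq> R \<and> (prune R K ^^ k) (U - top_set R K U) = {}"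
  then show "\<exists>F. single_valued F \<and> F \<subseteq> R \<and> K \<subseteq> F\<^sup>*"
    using forest_imp_routing[OF fin KU _ R(2)] prune_pow_forest fin by blast
qed

section \<open>Structured programs on the random access machine\<close>

type_synonym memory = "nat \<Rightarrow> nat"
type_synonym code = "nat \<Rightarrow> ram_instr list"

text \<open>Code is parameterised by its start address, as the jumps of the machine are absolute.\<close>

definition runs :: "bool list \<Rightarrow> code \<Rightarrow> memory \<Rightarrow> nat \<Rightarrow> memory \<Rightarrow> bool" where
  "runs x c R B R' \<longleftrightarrow>
     (\<forall>pre post. \<exists>t\<le>B. (ram_step (pre @ c (length pre) @ post) x ^^ t) (length pre, R) =
        (length pre + length (c (length pre)), R'))"

definition instr :: "ram_instr \<Rightarrow> code" where
  "instr i = (\<lambda>_. [i])"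

definition seq :: "code \<Rightarrow> code \<Rightarrow> code" (infixr \<open>;;\<close> 60) where
  "(c1 ;; c2) = (\<lambda>a. c1 a @ c2 (a + length (c1 a)))"

text \<open>The offset \<open>2\<close> counts the test and the jump back, which enclose the
  body.\<close>

definition loop :: "nat \<Rightarrow> code \<Rightarrow> code" where
  "loop r c = (\<lambda>a. Jzero r (a + length (c (Suc a)) + 2) # c (Suc a) @ [Jump a])"

lemma runs_mono: "runs x c R B R' \<Longrightarrow> B \<le> B' \<Longrightarrow> runs x c R B' R'"
  unfolding runs_def by (meson le_trans)

lemma runs_instr:
  assumes "\<And>pc. ram_exec x i (pc, R) = (Suc pc, R')"
  shows "runs x (instr i) R 1 R'"
  unfolding runs_def
  by (intro allI exI[of _ 1])
    (use assms in \<open>auto simp: instr_def ram_step_def ram_halted_def\<close>)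

lemma runs_Const: "runs x (instr (Const d k)) R 1 (R(d := k))"
  and runs_Move: "runs x (instr (Move d a)) R 1 (R(d := R a))"
  and runs_Add: "runs x (instr (Add d a b)) R 1 (R(d := R a + R b))"
  and runs_Sub: "runs x (instr (Sub d a b)) R 1 (R(d := R a - R b))"
  and runs_Load: "runs x (instr (Load d a)) R 1 (R(d := R (R a)))"
  and runs_Store: "runs x (instr (Store a b)) R 1 (R(R a := R b))"
  and runs_Read: "runs x (instr (Read d a)) R 1 (R(d := of_bool (R a < length x \<and> x ! R a)))"
  by (rule runs_instr; simp)+

text \<open>\<open>runs\<close> speaks of all surrounding code, so the first piece can be absorbed
  into the prefix of the second.\<close>

lemma runs_seq:
  assumes "runs x c1 R B1 R1" "runs x c2 R1 B2 R2"
  shows "runs x (c1 ;; c2) R (B1 + B2) R2"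
  unfolding runs_def
proof (intro allI)
  fix pre post :: "ram_instr list"
  let ?p = "c1 (length pre)"
  let ?q = "c2 (length pre + length ?p)"
  let ?P = "pre @ ?p @ ?q @ post"
  obtain t1 where t1: "t1 \<le> B1"
    "(ram_step ?P x ^^ t1) (length pre, R) = (length pre + length ?p, R1)"
    using assms(1) unfolding runs_def by blast
  obtain t2 where t2: "t2 \<le> B2"
    "(ram_step ((pre @ ?p) @ ?q @ post) x ^^ t2) (length (pre @ ?p), R1) =
       (length (pre @ ?p) + length ?q, R2)"
    using assms(2)[unfolded runs_def, rule_format, of "pre @ ?p" post] by auto
  have "(ram_step ?P x ^^ (t2 + t1)) (length pre, R) = (length pre + length ?p + length ?q, R2)"
    using t1 t2 by (simp add: funpow_add)
  then show "\<exists>t\<le>B1 + B2. (ram_step (pre @ (c1 ;; c2) (length pre) @ post) x ^^ t) (length pre, R) =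
      (length pre + length ((c1 ;; c2) (length pre)), R2)"
    using t1 t2 by (intro exI[of _ "t2 + t1"]) (simp add: seq_def add.assoc)
qed

lemma runs_loop_zero:
  assumes "R r = 0"
  shows "runs x (loop r c) R 1 R"
  unfolding runs_def
  by (intro allI exI[of _ 1]) (use assms in \<open>auto simp: loop_def ram_step_def ram_halted_def nth_append\<close>)

lemma runs_loop_step:
  assumes "R r \<noteq> 0" "runs x c R B1 R1" "runs x (loop r c) R1 B2 R2"
  shows "runs x (loop r c) R (B1 + 2 + B2) R2"
  unfolding runs_def
proof (intro allI)
  fix pre post :: "ram_instr list"
  let ?a = "length pre"
  let ?p = "c (Suc ?a)"
  let ?P = "pre @ loop r c ?a @ post"
  \<comment> \<open>For the body, the test is the end of the prefix and the jump back is the start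
    of the suffix.\<close>
  have P: "?P = (pre @ [Jzero r (?a + length ?p + 2)]) @ ?p @ (Jump ?a # post)"
    by (simp add: loop_def)
  obtain t1 where t1: "t1 \<le> B1" "(ram_step ?P x ^^ t1) (Suc ?a, R) = (Suc ?a + length ?p, R1)"
    unfolding P using assms(2)[unfolded runs_def, rule_format,
      of "pre @ [Jzero r (?a + length ?p + 2)]" "Jump ?a # post"] by auto
  obtain t2 where t2: "t2 \<le> B2"
    "(ram_step ?P x ^^ t2) (?a, R1) = (?a + length (loop r c ?a), R2)"
    using assms(3) unfolding runs_def by blast
  have "ram_step ?P x (?a, R) = (Suc ?a, R)"
    using assms(1) by (simp add: ram_step_def ram_halted_def loop_def nth_append)
  moreover have "ram_step ?P x (Suc ?a + length ?p, R1) = (?a, R1)"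
    by (simp add: ram_step_def ram_halted_def loop_def nth_append)
  ultimately have "(ram_step ?P x ^^ (t2 + (1 + (t1 + 1)))) (?a, R) = (?a + length (loop r c ?a), R2)"
    using t1(2) t2(2) unfolding funpow_add by simp
  then show "\<exists>t\<le>B1 + 2 + B2. (ram_step ?P x ^^ t) (?a, R) = (?a + length (loop r c ?a), R2)"
    using t1(1) t2(1) by (intro exI[of _ "t2 + (1 + (t1 + 1))"]) simp
qed

text \<open>\<open>J\<close> is indexed by the rounds done, while register \<open>k\<close> counts
  those left. A round costs two extra steps, for the test and the jump; the final \<open>1\<close>
  is the last test.\<close>

lemma runs_repeat:
  assumes step: "\<And>i R. i < m \<Longrightarrow> J i R \<Longrightarrow> R k = m - i \<Longrightarrow>
      \<exists>R'. runs x c R B R' \<and> J (Suc i) R' \<and> R' k = m - Suc i"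
    and J: "J 0 R" and k: "R k = m"
  shows "\<exists>R'. runs x (loop k c) R (m * (B + 2) + 1) R' \<and> J m R'"
proof -
  have "\<exists>R'. runs x (loop k c) R ((m - i) * (B + 2) + 1) R' \<and> J m R'"
    if "i \<le> m" "J i R" "R k = m - i" for i R
    using that
  proof (induction i arbitrary: R rule: inc_induct)
    case base
    then show ?case using runs_loop_zero[of R k x c] by auto
  next
    case (step i)
    obtain R1 where R1: "runs x c R B R1" "J (Suc i) R1" "R1 k = m - Suc i"
      using assms(1)[of i R] step by blast
    obtain R2 where R2: "runs x (loop k c) R1 ((m - Suc i) * (B + 2) + 1) R2" "J m R2"
      using step.IH[OF R1(2,3)] by blast
    have "runs x (loop k c) R (B + 2 + ((m - Suc i) * (B + 2) + 1)) R2"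
      using step by (intro runs_loop_step[OF _ R1(1) R2(1)]) auto
    moreover have "B + 2 + ((m - Suc i) * (B + 2) + 1) = (m - i) * (B + 2) + 1"
      using step(2) by (simp add: Suc_diff_Suc[symmetric])
    ultimately show ?case using R2(2) by metis
  qed
  from this[of 0 R] J k show ?thesis by simp
qed

text \<open>
  The variable \<open>v\<close> lives in register \<open>2 * v\<close>, where variables \<open>0\<close> and \<open>1\<close> hold
  the input length and the constant \<open>1\<close>. The even registers from \<open>2 * d\<close> on are scratch space,
  and the odd registers hold tables.
\<close>

definition for_loop :: "nat \<Rightarrow> nat \<Rightarrow> code \<Rightarrow> code" where
  "for_loop v d c =
     (instr (Move (2 * d) (2 * v)) ;; instr (Const (2 * v) 0) ;; instr (Move (2 * (d + 1)) 0) ;;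
      loop (2 * (d + 1)) (c ;; instr (Add (2 * v) (2 * v) 2) ;;
        instr (Sub (2 * (d + 1)) (2 * (d + 1)) 2)) ;;
      instr (Move (2 * v) (2 * d)))"

text \<open>\<open>frame\<close> makes the invariant blind to the three registers that the loop
  itself writes. Counting takes two steps per round and loop control two more; the \<open>5\<close>
  consists of three initial instructions, the last test and restoring \<open>v\<close>.\<close>

lemma runs_for_loop:
  assumes v: "2 \<le> v" "v < d" and R: "R 0 = L" "R 2 = 1"
    and frame: "\<And>i R R'. J i R \<Longrightarrow> (\<And>a. a \<notin> {2 * v, 2 * d, 2 * (d + 1)} \<Longrightarrow> R' a = R a) \<Longrightarrow> J i R'"
    and step: "\<And>i R. i < L \<Longrightarrow> J i R \<Longrightarrow> R (2 * v) = i \<Longrightarrow>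
      \<exists>R'. runs x c R B R' \<and> J (Suc i) R' \<and> (\<forall>j\<in>{1, v, d, d + 1}. R' (2 * j) = R (2 * j))"
    and J: "J 0 R"
  shows "\<exists>R'. runs x (for_loop v d c) R (L * (B + 4) + 5) R' \<and> J L R' \<and>
           R' (2 * v) = R (2 * v)"
proof -
  define J' where "J' i R' \<longleftrightarrow> J i R' \<and> R' (2 * v) = i \<and> R' (2 * d) = R (2 * v) \<and> R' 2 = 1" for i R'
  let ?k = "2 * (d + 1)"
  let ?c = "c ;; instr (Add (2 * v) (2 * v) 2) ;; instr (Sub ?k ?k 2)"
  define R1 where "R1 = R(2 * d := R (2 * v), 2 * v := 0, ?k := L)"
  have "J 0 R1" by (rule frame[OF J]) (simp add: R1_def)
  then have J1: "J' 0 R1" "R1 ?k = L" using v R by (auto simp: J'_def R1_def)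
  have "\<exists>R''. runs x ?c R' (B + (1 + 1)) R'' \<and> J' (Suc i) R'' \<and> R'' ?k = L - Suc i"
    if i: "i < L" "J' i R'" "R' ?k = L - i" for i R'
  proof -
    obtain S where S: "runs x c R' B S" "J (Suc i) S" "\<forall>j\<in>{1, v, d, d + 1}. S (2 * j) = R' (2 * j)"
      using step[of i R'] i unfolding J'_def by blast
    have Sv: "S 2 = 1" "S (2 * v) = i" "S (2 * d) = R (2 * v)" "S ?k = L - i"
      using S(3) i by (auto simp: J'_def)
    let ?S1 = "S(2 * v := Suc i)" and ?S2 = "S(2 * v := Suc i, ?k := L - Suc i)"
    have "runs x (instr (Add (2 * v) (2 * v) 2)) S 1 ?S1"
      using runs_Add[of x "2 * v" "2 * v" 2 S] Sv by simp
    moreover have "runs x (instr (Sub ?k ?k 2)) ?S1 1 ?S2"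
      using runs_Sub[of x ?k ?k 2 ?S1] Sv v by simp
    ultimately have "runs x ?c R' (B + (1 + 1)) ?S2" by (intro runs_seq[OF S(1)] runs_seq)
    moreover have "J (Suc i) ?S2" by (rule frame[OF S(2)]) simp
    then have "J' (Suc i) ?S2" using Sv v unfolding J'_def by auto
    ultimately show ?thesis by auto
  qed
  then obtain R2 where R2: "runs x (loop ?k ?c) R1 (L * (B + (1 + 1) + 2) + 1) R2" "J' L R2"
    using runs_repeat[of L J' ?k x ?c "B + (1 + 1)", OF _ J1] by blast
  let ?R3 = "R2(2 * v := R2 (2 * d))"
  have m1: "runs x (instr (Move (2 * d) (2 * v))) R 1 (R(2 * d := R (2 * v)))" by (rule runs_Move)
  have m2: "runs x (instr (Const (2 * v) 0)) (R(2 * d := R (2 * v))) 1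
      (R(2 * d := R (2 * v), 2 * v := 0))" by (rule runs_Const)
  have m3: "runs x (instr (Move ?k 0)) (R(2 * d := R (2 * v), 2 * v := 0)) 1 R1"
    using runs_Move[of x ?k 0 "R(2 * d := R (2 * v), 2 * v := 0)"] v R by (simp add: R1_def)
  have "runs x (for_loop v d c) R (1 + (1 + (1 + ((L * (B + (1 + 1) + 2) + 1) + 1)))) ?R3"
    unfolding for_loop_def by (rule runs_seq m1 m2 m3 R2 runs_Move)+
  moreover have "J L R2" using R2(2) by (simp add: J'_def)
  then have "J L ?R3" by (rule frame) simp
  moreover have "?R3 (2 * v) = R (2 * v)" using R2(2) by (simp add: J'_def)
  moreover have "1 + (1 + (1 + ((L * (B + (1 + 1) + 2) + 1) + 1))) = L * (B + 4) + 5" by (simp add: algebra_simps)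
  ultimately show ?thesis by metis
qed

section \<open>Arithmetic terms\<close>

datatype tm = C nat | V nat | Plus tm tm | Times tm tm

fun tval :: "(nat \<Rightarrow> nat) \<Rightarrow> tm \<Rightarrow> nat" where
  "tval e (C k) = k"
| "tval e (V v) = e v"
| "tval e (Plus s t) = tval e s + tval e t"
| "tval e (Times s t) = tval e s * tval e t"

fun tvars :: "tm \<Rightarrow> nat set" where
  "tvars (C k) = {}"
| "tvars (V v) = {v}"
| "tvars (Plus s t) = tvars s \<union> tvars t"
| "tvars (Times s t) = tvars s \<union> tvars t"

text \<open>Multiplication is repeated addition, so its running time depends on the value of a
  factor. Hence values need polynomial bounds as well.\<close>

fun tbound :: "tm \<Rightarrow> nat poly" where
  "tbound (C k) = [:k:]"
| "tbound (V v) = [:0, 1:]"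
| "tbound (Plus s t) = tbound s + tbound t"
| "tbound (Times s t) = tbound s * tbound t"

fun ttime :: "tm \<Rightarrow> nat poly" where
  "ttime (C k) = 1"
| "ttime (V v) = 1"
| "ttime (Plus s t) = ttime s + ttime t + 1"
| "ttime (Times s t) = ttime s + ttime t + 4 * tbound s + 3"

fun compile_tm :: "tm \<Rightarrow> nat \<Rightarrow> code" where
  "compile_tm (C k) d = instr (Const (2 * d) k)"
| "compile_tm (V v) d = instr (Move (2 * d) (2 * v))"
| "compile_tm (Plus s t) d =
     (compile_tm s d ;; compile_tm t (d + 1) ;; instr (Add (2 * d) (2 * d) (2 * (d + 1))))"
| "compile_tm (Times s t) d =
     (compile_tm s d ;; compile_tm t (d + 1) ;; instr (Const (2 * (d + 2)) 0) ;;
      loop (2 * d) (instr (Add (2 * (d + 2)) (2 * (d + 2)) (2 * (d + 1))) ;;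
        instr (Sub (2 * d) (2 * d) 2)) ;;
      instr (Move (2 * d) (2 * (d + 2))))"

text \<open>The contract of code that returns its result in register \<open>2 * d\<close>: the
  tables and all lower registers survive.\<close>

definition same :: "nat \<Rightarrow> memory \<Rightarrow> memory \<Rightarrow> bool" where
  "same d R R' \<longleftrightarrow> (\<forall>a. odd a \<or> a < 2 * d \<longrightarrow> R' a = R a)"

type_synonym tables = "nat \<Rightarrow> nat \<Rightarrow> nat \<Rightarrow> bool"

text \<open>A number with digits \<open>i\<close>, \<open>a\<close>, \<open>b\<close> in base
  \<open>L\<close>, moved to the odd registers. The leading digit is unbounded, so the number of
  tables need not be fixed.\<close>

definition address :: "nat \<Rightarrow> nat \<Rightarrow> nat \<Rightarrow> nat \<Rightarrow> nat" where
  "address L i a b = Suc (2 * ((i * L + a) * L + b))"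

lemma odd_address: "odd (address L i a b)"
  by (simp add: address_def)

lemma address_neq: "address L i a b \<noteq> 2 * j" "address L i a b \<noteq> 0"
  unfolding address_def using double_not_eq_Suc_double by (metis, simp)

definition stored :: "nat \<Rightarrow> tables \<Rightarrow> memory \<Rightarrow> bool" where
  "stored L \<rho> R \<longleftrightarrow> (\<forall>i a b. a < L \<longrightarrow> b < L \<longrightarrow> R (address L i a b) = of_bool (\<rho> i a b))"

text \<open>\<open>0 < L\<close> lets the constant \<open>1\<close> in variable \<open>1\<close>
  obey the bound \<open>L\<close> that \<open>tbound\<close> uses for every variable.\<close>

definition admissible :: "nat \<Rightarrow> nat \<Rightarrow> (nat \<Rightarrow> nat) \<Rightarrow> bool" where
  "admissible N L e \<longleftrightarrow> 0 < L \<and> 2 \<le> N \<and> e 0 = L \<and> e 1 = 1 \<and> (\<forall>j. 2 \<le> j \<longrightarrow> j < N \<longrightarrow> e j < L)"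

definition state :: "nat \<Rightarrow> nat \<Rightarrow> (nat \<Rightarrow> nat) \<Rightarrow> tables \<Rightarrow> memory \<Rightarrow> bool" where
  "state N L e \<rho> R \<longleftrightarrow> admissible N L e \<and> (\<forall>j<N. R (2 * j) = e j) \<and> stored L \<rho> R"

lemma admissible_le: "admissible N L e \<Longrightarrow> j < N \<Longrightarrow> e j \<le> L"
  unfolding admissible_def by (cases "j = 0"; cases "j = 1") (auto simp: not_less_eq_eq less_imp_le)

lemma admissible_upd: "admissible N L e \<Longrightarrow> 2 \<le> v \<Longrightarrow> a < L \<Longrightarrow> admissible N L (e(v := a))"
  unfolding admissible_def by auto

lemma state_regs:
  assumes "state N L e \<rho> R"
  shows "R 0 = L" "R 2 = 1" "j < N \<Longrightarrow> R (2 * j) = e j"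
  using assms unfolding state_def admissible_def by (auto dest: spec[of _ 0] spec[of _ 1])

lemma same_refl: "same d R R"
  by (simp add: same_def)

lemma same_trans: "same d R S \<Longrightarrow> same d' S T \<Longrightarrow> d \<le> d' \<Longrightarrow> same d R T"
  unfolding same_def by auto

lemma same_upd: "same d R S \<Longrightarrow> d \<le> j \<Longrightarrow> same d R (S(2 * j := k))"
  unfolding same_def by auto

lemma same_get: "same d R S \<Longrightarrow> j < d \<Longrightarrow> S (2 * j) = R (2 * j)"
  unfolding same_def by auto

lemma state_same: "state N L e \<rho> R \<Longrightarrow> same d R S \<Longrightarrow> N \<le> d \<Longrightarrow> state N L e \<rho> S"
  unfolding state_def stored_def same_def address_def by auto

lemma result_in_register:
  assumes "runs x c R B (S(2 * d := k))" "same d R S" "B \<le> B'"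
  shows "\<exists>R'. runs x c R B' R' \<and> R' (2 * d) = k \<and> same d R R'"
  using runs_mono[OF assms(1,3)] same_upd[OF assms(2) order_refl, of k] fun_upd_same by metis

lemma tval_le_tbound:
  assumes "admissible N L e" "tvars t \<subseteq> {..<N}"
  shows "tval e t \<le> poly (tbound t) L"
  using assms(2) by (induction t) (auto intro: admissible_le[OF assms(1)] add_mono mult_mono)

lemma runs_compile_tm:
  assumes "state N L e \<rho> R" "tvars t \<subseteq> {..<N}" "N \<le> d"
  shows "\<exists>R'. runs x (compile_tm t d) R (poly (ttime t) L) R' \<and> R' (2 * d) = tval e t \<and> same d R R'"
  using assms
proof (induction t arbitrary: d R)
  case (C k)
  show ?case by (rule result_in_register[OF _ same_refl]) (auto intro: runs_Const[unfolded One_nat_def])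
next
  case (V v)
  then have "R (2 * v) = e v" by (simp add: state_regs)
  then show ?case using runs_Move[of x "2 * d" "2 * v" R]
    by (intro result_in_register[OF _ same_refl]) auto
next
  case (Plus s t)
  obtain R1 where R1: "runs x (compile_tm s d) R (poly (ttime s) L) R1" "R1 (2 * d) = tval e s" "same d R R1"
    using Plus.IH(1)[of R d] Plus.prems by auto
  obtain R2 where R2: "runs x (compile_tm t (d + 1)) R1 (poly (ttime t) L) R2"
    "R2 (2 * (d + 1)) = tval e t" "same (d + 1) R1 R2"
    using Plus.IH(2)[of R1 "d + 1"] Plus.prems state_same[OF _ R1(3)] by auto
  have "R2 (2 * d) = tval e s" using same_get[OF R2(3), of d] R1(2) by simp
  then have "runs x (instr (Add (2 * d) (2 * d) (2 * (d + 1)))) R2 1 (R2(2 * d := tval e s + tval e t))"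
    using runs_Add[of x "2 * d" "2 * d" "2 * (d + 1)" R2] R2 by simp
  then have "runs x (compile_tm (Plus s t) d) R (poly (ttime s) L + (poly (ttime t) L + 1))
      (R2(2 * d := tval e s + tval e t))"
    unfolding compile_tm.simps by (intro runs_seq[OF R1(1)] runs_seq[OF R2(1)])
  then show ?case unfolding tval.simps
    by (rule result_in_register) (use same_trans[OF R1(3) R2(3)] in auto)
next
  case (Times s t)
  obtain R1 where R1: "runs x (compile_tm s d) R (poly (ttime s) L) R1" "R1 (2 * d) = tval e s" "same d R R1"
    using Times.IH(1)[of R d] Times.prems by auto
  obtain R2 where R2: "runs x (compile_tm t (d + 1)) R1 (poly (ttime t) L) R2"
    "R2 (2 * (d + 1)) = tval e t" "same (d + 1) R1 R2"
    using Times.IH(2)[of R1 "d + 1"] Times.prems state_same[OF _ R1(3)] by auto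
  have s: "R2 (2 * d) = tval e s" using same_get[OF R2(3), of d] R1(2) by simp
  let ?m = "tval e s" and ?n = "tval e t"
  let ?acc = "2 * (d + 2)"
  define J where "J i S \<longleftrightarrow> S ?acc = i * ?n \<and> S (2 * (d + 1)) = ?n \<and> same d R S" for i S
  let ?R3 = "R2(?acc := 0)"
  let ?c = "instr (Add ?acc ?acc (2 * (d + 1))) ;; instr (Sub (2 * d) (2 * d) 2)"
  have "same d R ?R3" using same_trans[OF R1(3) R2(3)] by (intro same_upd) auto
  then have J3: "J 0 ?R3" "?R3 (2 * d) = ?m" using R2(2) s by (auto simp: J_def)
  have "\<exists>S'. runs x ?c S (1 + 1) S' \<and> J (Suc i) S' \<and> S' (2 * d) = ?m - Suc i"
    if "i < ?m" "J i S" "S (2 * d) = ?m - i" for i S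
  proof -
    have "state N L e \<rho> S" using state_same[of N L e \<rho> R d S] that Times.prems by (simp add: J_def)
    then have S2: "S 2 = 1" "2 \<le> d" using Times.prems(3) state_regs(2)
      by (blast, auto simp: state_def admissible_def)
    let ?S1 = "S(?acc := Suc i * ?n)"
    have "runs x (instr (Add ?acc ?acc (2 * (d + 1)))) S 1 ?S1"
      using runs_Add[of x ?acc ?acc "2 * (d + 1)" S] that by (simp add: J_def add.commute)
    moreover have "runs x (instr (Sub (2 * d) (2 * d) 2)) ?S1 1 (?S1(2 * d := ?m - Suc i))"
      using runs_Sub[of x "2 * d" "2 * d" 2 ?S1] that S2 by simp
    ultimately have "runs x ?c S (1 + 1) (?S1(2 * d := ?m - Suc i))" by (rule runs_seq)
    moreover have "same d R (?S1(2 * d := ?m - Suc i))"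
      using that(2) unfolding J_def by (intro same_upd) auto
    then have "J (Suc i) (?S1(2 * d := ?m - Suc i))"
      using that unfolding J_def by auto
    ultimately show ?thesis by (metis fun_upd_same)
  qed
  then obtain R4 where R4: "runs x (loop (2 * d) ?c) ?R3 (?m * (1 + 1 + 2) + 1) R4" "J ?m R4"
    using runs_repeat[of ?m J "2 * d" x ?c "1 + 1" ?R3, OF _ J3] by blast
  let ?R5 = "R4(2 * d := R4 ?acc)"
  have "runs x (compile_tm (Times s t) d) R
      (poly (ttime s) L + (poly (ttime t) L + (1 + ((?m * (1 + 1 + 2) + 1) + 1)))) ?R5"
    unfolding compile_tm.simps by (rule runs_seq R1 R2 R4 runs_Const runs_Move)+
  moreover have "poly (ttime s) L + (poly (ttime t) L + (1 + ((?m * (1 + 1 + 2) + 1) + 1)))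
      \<le> poly (ttime (Times s t)) L"
    using tval_le_tbound[of N L e s] Times.prems by (simp add: state_def)
  ultimately have "runs x (compile_tm (Times s t) d) R (poly (ttime (Times s t)) L) ?R5"
    by (rule runs_mono)
  then show ?case using R4(2)
    by (intro result_in_register[of _ _ _ _ R4]) (auto simp: J_def)
qed


section \<open>First-order formulas over the tables\<close>

datatype fm = Bit tm | Less tm tm | Rel nat nat nat | Neg fm | Disj fm fm | Exists nat fm

fun fsem :: "bool list \<Rightarrow> tables \<Rightarrow> (nat \<Rightarrow> nat) \<Rightarrow> fm \<Rightarrow> bool" where
  "fsem x \<rho> e (Bit t) \<longleftrightarrow> tval e t < length x \<and> x ! tval e t"
| "fsem x \<rho> e (Less s t) \<longleftrightarrow> tval e s < tval e t"
| "fsem x \<rho> e (Rel i u v) \<longleftrightarrow> \<rho> i (e u) (e v)"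
| "fsem x \<rho> e (Neg p) \<longleftrightarrow> \<not> fsem x \<rho> e p"
| "fsem x \<rho> e (Disj p q) \<longleftrightarrow> fsem x \<rho> e p \<or> fsem x \<rho> e q"
| "fsem x \<rho> e (Exists v p) \<longleftrightarrow> (\<exists>a<length x. fsem x \<rho> (e(v := a)) p)"

fun fm_ok :: "nat \<Rightarrow> fm \<Rightarrow> bool" where
  "fm_ok N (Bit t) \<longleftrightarrow> tvars t \<subseteq> {..<N}"
| "fm_ok N (Less s t) \<longleftrightarrow> tvars s \<subseteq> {..<N} \<and> tvars t \<subseteq> {..<N}"
| "fm_ok N (Rel i u v) \<longleftrightarrow> u \<in> {2..<N} \<and> v \<in> {2..<N}"
| "fm_ok N (Neg p) \<longleftrightarrow> fm_ok N p"
| "fm_ok N (Disj p q) \<longleftrightarrow> fm_ok N p \<and> fm_ok N q"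
| "fm_ok N (Exists v p) \<longleftrightarrow> v \<in> {2..<N} \<and> fm_ok N p"

definition cell :: "nat \<Rightarrow> nat \<Rightarrow> nat \<Rightarrow> tm" where
  "cell i u v = Plus (Times (Plus (Times (C i) (V 0)) (V u)) (V 0)) (V v)"

definition compile_cell :: "nat \<Rightarrow> nat \<Rightarrow> nat \<Rightarrow> nat \<Rightarrow> code" where
  "compile_cell i u v d =
     (compile_tm (cell i u v) d ;; instr (Add (2 * d) (2 * d) (2 * d)) ;;
      instr (Add (2 * d) (2 * d) 2))"

text \<open>Register \<open>2\<close> holds \<open>1\<close>; truncated subtraction from
  \<open>1\<close>, done twice, turns every nonzero value into \<open>1\<close>.\<close>

definition norm_code :: "nat \<Rightarrow> code" where
  "norm_code d = (instr (Sub (2 * d) 2 (2 * d)) ;; instr (Sub (2 * d) 2 (2 * d)))"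

fun compile_fm :: "fm \<Rightarrow> nat \<Rightarrow> code" where
  "compile_fm (Bit t) d = (compile_tm t d ;; instr (Read (2 * d) (2 * d)))"
| "compile_fm (Less s t) d =
     (compile_tm s d ;; compile_tm t (d + 1) ;; instr (Sub (2 * d) (2 * (d + 1)) (2 * d)) ;;
      norm_code d)"
| "compile_fm (Rel i u v) d = (compile_cell i u v d ;; instr (Load (2 * d) (2 * d)))"
| "compile_fm (Neg p) d = (compile_fm p d ;; instr (Sub (2 * d) 2 (2 * d)))"
| "compile_fm (Disj p q) d =
     (compile_fm p d ;; compile_fm q (d + 1) ;; instr (Add (2 * d) (2 * d) (2 * (d + 1))) ;;
      norm_code d)"
| "compile_fm (Exists v p) d =
     (instr (Const (2 * d) 0) ;;
      for_loop v (d + 1)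
        (compile_fm p (d + 3) ;; instr (Add (2 * d) (2 * d) (2 * (d + 3)))) ;;
      norm_code d)"

fun ftime :: "fm \<Rightarrow> nat poly" where
  "ftime (Bit t) = ttime t + 1"
| "ftime (Less s t) = ttime s + ttime t + 3"
| "ftime (Rel i u v) = ttime (cell i u v) + 3"
| "ftime (Neg p) = ftime p + 1"
| "ftime (Disj p q) = ftime p + ftime q + 3"
| "ftime (Exists v p) = [:0, 1:] * (ftime p + 5) + 8"

lemma runs_norm_code:
  assumes "R 2 = 1" "2 \<le> d"
  shows "runs x (norm_code d) R 2 (R(2 * d := of_bool (R (2 * d) \<noteq> 0)))"
proof -
  let ?R1 = "R(2 * d := 1 - R (2 * d))"
  have "runs x (instr (Sub (2 * d) 2 (2 * d))) R 1 ?R1"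
    using runs_Sub[of x "2 * d" 2 "2 * d" R] assms by simp
  moreover have "runs x (instr (Sub (2 * d) 2 (2 * d))) ?R1 1 (R(2 * d := of_bool (R (2 * d) \<noteq> 0)))"
    using runs_Sub[of x "2 * d" 2 "2 * d" ?R1] assms by (cases "R (2 * d) = 0") auto
  ultimately have "runs x (norm_code d) R (1 + 1) (R(2 * d := of_bool (R (2 * d) \<noteq> 0)))"
    unfolding norm_code_def by (rule runs_seq)
  then show ?thesis by (simp only: one_add_one)
qed

lemma runs_compile_cell:
  assumes "state N L e \<rho> R" "u \<in> {2..<N}" "v \<in> {2..<N}" "N \<le> d"
  shows "\<exists>R'. runs x (compile_cell i u v d) R (poly (ttime (cell i u v)) L + 2) R' \<and>
           R' (2 * d) = address L i (e u) (e v) \<and> same d R R'"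
proof -
  have N: "2 \<le> N" "e 0 = L" using assms(1) by (auto simp: state_def admissible_def)
  then have "tvars (cell i u v) \<subseteq> {..<N}" using assms by (auto simp: cell_def)
  then obtain S where S: "runs x (compile_tm (cell i u v) d) R (poly (ttime (cell i u v)) L) S"
    "S (2 * d) = tval e (cell i u v)" "same d R S"
    using runs_compile_tm[OF assms(1) _ assms(4)] by blast
  have S2: "S 2 = 1" using state_regs(2)[OF state_same[OF assms(1) S(3) assms(4)]] .
  let ?n = "(i * L + e u) * L + e v"
  have n: "S (2 * d) = ?n" using S(2) N by (simp add: cell_def)
  have "runs x (instr (Add (2 * d) (2 * d) (2 * d))) S 1 (S(2 * d := 2 * ?n))"
    using runs_Add[of x "2 * d" "2 * d" "2 * d" S] n by (metis mult_2)
  moreover have "runs x (instr (Add (2 * d) (2 * d) 2)) (S(2 * d := 2 * ?n)) 1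
      (S(2 * d := address L i (e u) (e v)))"
    using runs_Add[of x "2 * d" "2 * d" 2 "S(2 * d := 2 * ?n)"] S2 N assms(4)
    by (simp add: address_def)
  ultimately have "runs x (compile_cell i u v d) R (poly (ttime (cell i u v)) L + (1 + 1))
      (S(2 * d := address L i (e u) (e v)))"
    unfolding compile_cell_def by (intro runs_seq[OF S(1)] runs_seq)
  then show ?thesis by (rule result_in_register) (use S in auto)
qed

lemma runs_compile_fm:
  assumes "state N (length x) e \<rho> R" "fm_ok N p" "N \<le> d"
  shows "\<exists>R'. runs x (compile_fm p d) R (poly (ftime p) (length x)) R' \<and>
           R' (2 * d) = of_bool (fsem x \<rho> e p) \<and> same d R R'"
  using assms
proof (induction p arbitrary: d R e)
  case (Bit t)
  obtain S where S: "runs x (compile_tm t d) R (poly (ttime t) (length x)) S"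
    "S (2 * d) = tval e t" "same d R S"
    using runs_compile_tm[OF Bit(1) _ Bit(3), of t x] Bit(2) by auto
  have "runs x (compile_fm (Bit t) d) R (poly (ttime t) (length x) + 1)
      (S(2 * d := of_bool (fsem x \<rho> e (Bit t))))"
    using runs_seq[OF S(1) runs_Read[of x "2 * d" "2 * d" S]] S(2) by simp
  then show ?case by (rule result_in_register) (use S in auto)
next
  case (Less s t)
  obtain R1 where R1: "runs x (compile_tm s d) R (poly (ttime s) (length x)) R1"
    "R1 (2 * d) = tval e s" "same d R R1"
    using runs_compile_tm[OF Less(1) _ Less(3), of s x] Less(2) by auto
  note st1 = state_same[OF Less(1) R1(3) Less(3)]
  obtain R2 where R2: "runs x (compile_tm t (d + 1)) R1 (poly (ttime t) (length x)) R2"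
    "R2 (2 * (d + 1)) = tval e t" "same (d + 1) R1 R2"
    using runs_compile_tm[OF st1, of t "d + 1" x] Less(2,3) by auto
  have s: "R2 (2 * d) = tval e s" using same_get[OF R2(3), of d] R1(2) by simp
  have R22: "R2 2 = 1" "2 \<le> d"
    using state_regs(2)[OF state_same[OF st1 R2(3)]] Less by (auto simp: state_def admissible_def)
  let ?R3 = "R2(2 * d := tval e t - tval e s)"
  have R3: "runs x (instr (Sub (2 * d) (2 * (d + 1)) (2 * d))) R2 1 ?R3"
    using runs_Sub[of x "2 * d" "2 * (d + 1)" "2 * d" R2] s R2(2) by simp
  have n: "?R3 (2 * d) \<noteq> 0 \<longleftrightarrow> fsem x \<rho> e (Less s t)" by auto
  have "runs x (norm_code d) ?R3 2 (R2(2 * d := of_bool (fsem x \<rho> e (Less s t))))"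
    using runs_norm_code[of ?R3 d x] R22 unfolding n by simp
  from runs_seq[OF R1(1) runs_seq[OF R2(1) runs_seq[OF R3 this]]]
  have "runs x (compile_fm (Less s t) d) R
      (poly (ttime s) (length x) + (poly (ttime t) (length x) + (1 + 2)))
      (R2(2 * d := of_bool (fsem x \<rho> e (Less s t))))"
    by simp
  then show ?case
    by (rule result_in_register) (use same_trans[OF R1(3) R2(3)] in auto)
next
  case (Rel i u v)
  obtain S where S: "runs x (compile_cell i u v d) R (poly (ttime (cell i u v)) (length x) + 2) S"
    "S (2 * d) = address (length x) i (e u) (e v)" "same d R S"
    using runs_compile_cell[OF Rel(1) _ _ Rel(3)] Rel(2) by fastforce
  have "stored (length x) \<rho> S" using state_same[OF Rel(1) S(3) Rel(3)] by (simp add: state_def)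
  moreover have "e u < length x" "e v < length x"
    using Rel(1,2) by (auto simp: state_def admissible_def)
  ultimately have "S (address (length x) i (e u) (e v)) = of_bool (\<rho> i (e u) (e v))"
    by (simp add: stored_def)
  then have "runs x (compile_fm (Rel i u v) d) R (poly (ttime (cell i u v)) (length x) + 2 + 1)
      (S(2 * d := of_bool (fsem x \<rho> e (Rel i u v))))"
    using runs_seq[OF S(1) runs_Load[of x "2 * d" "2 * d" S]] S(2) by simp
  then show ?case by (rule result_in_register) (use S in auto)
next
  case (Neg p)
  obtain S where S: "runs x (compile_fm p d) R (poly (ftime p) (length x)) S"
    "S (2 * d) = of_bool (fsem x \<rho> e p)" "same d R S"
    using Neg.IH[OF Neg.prems(1) _ Neg.prems(3)] Neg.prems(2) by auto
  have "S 2 = 1" using state_regs(2)[OF state_same[OF Neg.prems(1) S(3) Neg.prems(3)]] .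
  then have "runs x (compile_fm (Neg p) d) R (poly (ftime p) (length x) + 1)
      (S(2 * d := of_bool (fsem x \<rho> e (Neg p))))"
    using runs_seq[OF S(1) runs_Sub[of x "2 * d" 2 "2 * d" S]] S(2)
    by (cases "fsem x \<rho> e p") auto
  then show ?case by (rule result_in_register) (use S in auto)
next
  case (Disj p q)
  obtain R1 where R1: "runs x (compile_fm p d) R (poly (ftime p) (length x)) R1"
    "R1 (2 * d) = of_bool (fsem x \<rho> e p)" "same d R R1"
    using Disj.IH(1)[OF Disj.prems(1) _ Disj.prems(3)] Disj.prems(2) by auto
  note st1 = state_same[OF Disj.prems(1) R1(3) Disj.prems(3)]
  obtain R2 where R2: "runs x (compile_fm q (d + 1)) R1 (poly (ftime q) (length x)) R2"
    "R2 (2 * (d + 1)) = of_bool (fsem x \<rho> e q)" "same (d + 1) R1 R2"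
    using Disj.IH(2)[OF st1, of "d + 1"] Disj.prems(2,3) by auto
  have s: "R2 (2 * d) = of_bool (fsem x \<rho> e p)" using same_get[OF R2(3), of d] R1(2) by simp
  have R22: "R2 2 = 1" "2 \<le> d"
    using state_regs(2)[OF state_same[OF st1 R2(3)]] Disj.prems by (auto simp: state_def admissible_def)
  let ?R3 = "R2(2 * d := of_bool (fsem x \<rho> e p) + of_bool (fsem x \<rho> e q))"
  have R3: "runs x (instr (Add (2 * d) (2 * d) (2 * (d + 1)))) R2 1 ?R3"
    using runs_Add[of x "2 * d" "2 * d" "2 * (d + 1)" R2] s R2(2) by simp
  have n: "?R3 (2 * d) \<noteq> 0 \<longleftrightarrow> fsem x \<rho> e (Disj p q)" by auto
  have "runs x (norm_code d) ?R3 2 (R2(2 * d := of_bool (fsem x \<rho> e (Disj p q))))"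
    using runs_norm_code[of ?R3 d x] R22 unfolding n by simp
  from runs_seq[OF R1(1) runs_seq[OF R2(1) runs_seq[OF R3 this]]]
  have "runs x (compile_fm (Disj p q) d) R
      (poly (ftime p) (length x) + (poly (ftime q) (length x) + (1 + 2)))
      (R2(2 * d := of_bool (fsem x \<rho> e (Disj p q))))"
    by simp
  then show ?case
    by (rule result_in_register) (use same_trans[OF R1(3) R2(3)] in auto)
next
  case (Exists v p)
  let ?L = "length x"
  have v: "2 \<le> v" "v < d" "v < N" "2 \<le> d" using Exists.prems by auto
  \<comment> \<open>Register \<open>2 * d\<close> counts witnesses, of which only being nonzero
    matters. Variables \<open>d + 1\<close> and \<open>d + 2\<close> belong to the loop, so the body
    starts at \<open>d + 3\<close>. The register of \<open>v\<close> is exempt because the loop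
    varies it; it is restored at the end.\<close>
  define J where "J i S \<longleftrightarrow> (S (2 * d) \<noteq> 0 \<longleftrightarrow> (\<exists>a<i. fsem x \<rho> (e(v := a)) p)) \<and>
    (\<forall>a. odd a \<or> a < 2 * d \<longrightarrow> a \<noteq> 2 * v \<longrightarrow> S a = R a)" for i S
  let ?c = "compile_fm p (d + 3) ;; instr (Add (2 * d) (2 * d) (2 * (d + 3)))"
  have J: "J 0 (R(2 * d := 0))" by (auto simp: J_def)
  have body: "\<exists>S'. runs x ?c S (poly (ftime p) ?L + 1) S' \<and> J (Suc i) S' \<and>
      (\<forall>j\<in>{1, v, d + 1, d + 1 + 1}. S' (2 * j) = S (2 * j))"
    if i: "i < ?L" "J i S" "S (2 * v) = i" for i S
  proof -
    have "stored ?L \<rho> S"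
      using Exists.prems(1) i(2) unfolding state_def J_def stored_def by (simp add: odd_address address_neq)
    moreover have "\<forall>j<N. S (2 * j) = (e(v := i)) j"
      using Exists.prems(1,3) i(2,3) unfolding state_def J_def by auto
    ultimately have "state N ?L (e(v := i)) \<rho> S"
      using Exists.prems(1) i(1) v admissible_upd[of N ?L e v i] unfolding state_def by simp
    moreover have "fm_ok N p" "N \<le> d + 3" using Exists.prems by auto
    ultimately obtain S1 where S1: "runs x (compile_fm p (d + 3)) S (poly (ftime p) ?L) S1"
      "S1 (2 * (d + 3)) = of_bool (fsem x \<rho> (e(v := i)) p)" "same (d + 3) S S1"
      using Exists.IH by blast
    let ?S2 = "S1(2 * d := S (2 * d) + of_bool (fsem x \<rho> (e(v := i)) p))"
    have "runs x (instr (Add (2 * d) (2 * d) (2 * (d + 3)))) S1 1 ?S2"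
      using runs_Add[of x "2 * d" "2 * d" "2 * (d + 3)" S1] S1(2) same_get[OF S1(3), of d] by simp
    from runs_seq[OF S1(1) this] have "runs x ?c S (poly (ftime p) ?L + 1) ?S2" .
    moreover have "J (Suc i) ?S2"
    proof -
      have "S1 a = R a" if "odd a \<or> a < 2 * d" "a \<noteq> 2 * v" for a
        using that i(2) S1(3) unfolding J_def same_def by auto
      then show ?thesis using i(2) unfolding J_def by (auto simp: less_Suc_eq)
    qed
    moreover have "\<forall>j\<in>{1, v, d + 1, d + 1 + 1}. ?S2 (2 * j) = S (2 * j)"
      using v same_get[OF S1(3), of 1] same_get[OF S1(3), of v] same_get[OF S1(3), of "d + 1"]
        same_get[OF S1(3), of "d + 1 + 1"] by simp
    ultimately show ?thesis by blast
  qed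
  have frame: "J i S'" if "J i S" "\<And>a. a \<notin> {2 * v, 2 * (d + 1), 2 * (d + 1 + 1)} \<Longrightarrow> S' a = S a" for i S S'
  proof -
    have "S' a = S a" if "odd a \<or> a < 2 * d" "a \<noteq> 2 * v" for a
      using that by (intro \<open>\<And>a. a \<notin> _ \<Longrightarrow> S' a = S a\<close>) auto
    moreover have "S' (2 * d) = S (2 * d)"
      using v by (intro that(2)) auto
    ultimately show ?thesis using that(1) unfolding J_def by metis
  qed
  have "\<exists>S. runs x (for_loop v (d + 1) ?c) (R(2 * d := 0)) (?L * (poly (ftime p) ?L + 1 + 4) + 5) S \<and>
      J ?L S \<and> S (2 * v) = (R(2 * d := 0)) (2 * v)"
  proof (rule runs_for_loop[where J = J and L = ?L])
    show "(R(2 * d := 0)) 0 = ?L" "(R(2 * d := 0)) 2 = 1" "v < d + 1"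
      using state_regs[OF Exists.prems(1)] v by simp_all
  qed (fact v frame body J)+
  then obtain S where S: "runs x (for_loop v (d + 1) ?c) (R(2 * d := 0))
      (?L * (poly (ftime p) ?L + 1 + 4) + 5) S" "J ?L S" "S (2 * v) = R (2 * v)"
    using v by auto
  have same: "same d R S" using S(2,3) unfolding J_def same_def by metis
  have "S 2 = 1" using state_regs(2)[OF state_same[OF Exists.prems(1) same Exists.prems(3)]] .
  then have n: "runs x (norm_code d) S 2 (S(2 * d := of_bool (fsem x \<rho> e (Exists v p))))"
    using runs_norm_code[of S d x] v S(2) unfolding J_def by simp
  have "runs x (compile_fm (Exists v p) d) R (1 + ((?L * (poly (ftime p) ?L + 1 + 4) + 5) + 2))
      (S(2 * d := of_bool (fsem x \<rho> e (Exists v p))))"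
    unfolding compile_fm.simps by (rule runs_seq[OF runs_Const runs_seq[OF S(1) n]])
  then show ?case by (rule result_in_register[OF _ same]) (simp add: algebra_simps)
qed

section \<open>Programs that assign tables\<close>

datatype pg = Put nat nat nat fm | For nat pg | Seq pg pg

fun psem :: "bool list \<Rightarrow> (nat \<Rightarrow> nat) \<Rightarrow> pg \<Rightarrow> tables \<Rightarrow> tables" where
  "psem x e (Put i u v p) \<rho> =
     (\<lambda>j a b. if j = i \<and> a = e u \<and> b = e v then fsem x \<rho> e p else \<rho> j a b)"
| "psem x e (For v p) \<rho> = fold (\<lambda>a. psem x (e(v := a)) p) [0..<length x] \<rho>"
| "psem x e (Seq p q) \<rho> = psem x e q (psem x e p \<rho>)"

fun pg_ok :: "nat \<Rightarrow> pg \<Rightarrow> bool" where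
  "pg_ok N (Put i u v p) \<longleftrightarrow> u \<in> {2..<N} \<and> v \<in> {2..<N} \<and> fm_ok N p"
| "pg_ok N (For v p) \<longleftrightarrow> v \<in> {2..<N} \<and> pg_ok N p"
| "pg_ok N (Seq p q) \<longleftrightarrow> pg_ok N p \<and> pg_ok N q"

fun compile_pg :: "pg \<Rightarrow> nat \<Rightarrow> code" where
  "compile_pg (Put i u v p) d =
     (compile_cell i u v d ;; compile_fm p (d + 1) ;; instr (Store (2 * d) (2 * (d + 1))))"
| "compile_pg (For v p) d = for_loop v d (compile_pg p (d + 2))"
| "compile_pg (Seq p q) d = (compile_pg p d ;; compile_pg q d)"

fun ptime :: "pg \<Rightarrow> nat poly" where
  "ptime (Put i u v p) = ttime (cell i u v) + ftime p + 3"
| "ptime (For v p) = [:0, 1:] * (ptime p + 4) + 5"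
| "ptime (Seq p q) = ptime p + ptime q"

text \<open>As \<open>a\<close> and \<open>b\<close> are below \<open>L\<close>, division with
  remainder recovers the digits.\<close>

lemma address_inj:
  assumes "address L i a b = address L j c d" "a < L" "b < L" "c < L" "d < L"
  shows "i = j \<and> a = c \<and> b = d"
proof -
  have digits: "q = q' \<and> r = r'" if "q * L + r = q' * L + r'" "r < L" "r' < L" for q q' r r'
    using arg_cong[OF that(1), of "\<lambda>n. n div L"] arg_cong[OF that(1), of "\<lambda>n. n mod L"] that(2,3)
    by simp
  show ?thesis
    using digits[of "i * L + a" b "j * L + c" d] digits[of i a j c] assms by (simp add: address_def)
qed

lemma runs_compile_pg:
  assumes "state N (length x) e \<rho> R" "pg_ok N p" "N \<le> d"
  shows "\<exists>R'. runs x (compile_pg p d) R (poly (ptime p) (length x)) R' \<and>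
           state N (length x) e (psem x e p \<rho>) R' \<and> (\<forall>j<d. R' (2 * j) = R (2 * j))"
  using assms
proof (induction p arbitrary: d R e \<rho>)
  case (Put i u v p)
  let ?L = "length x"
  obtain R1 where R1: "runs x (compile_cell i u v d) R (poly (ttime (cell i u v)) ?L + 2) R1"
    "R1 (2 * d) = address ?L i (e u) (e v)" "same d R R1"
    using runs_compile_cell[OF Put(1) _ _ Put(3)] Put(2) by fastforce
  note st1 = state_same[OF Put(1) R1(3) Put(3)]
  obtain R2 where R2: "runs x (compile_fm p (d + 1)) R1 (poly (ftime p) ?L) R2"
    "R2 (2 * (d + 1)) = of_bool (fsem x \<rho> e p)" "same (d + 1) R1 R2"
    using runs_compile_fm[OF st1, of p "d + 1"] Put(2,3) by auto
  have st2: "state N ?L e \<rho> R2" using state_same[OF st1 R2(3)] Put(3) by simp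
  have a: "R2 (2 * d) = address ?L i (e u) (e v)" using same_get[OF R2(3), of d] R1(2) by simp
  have uv: "e u < ?L" "e v < ?L" using Put(1,2) by (auto simp: state_def admissible_def)
  let ?R3 = "R2(address ?L i (e u) (e v) := of_bool (fsem x \<rho> e p))"
  have "runs x (instr (Store (2 * d) (2 * (d + 1)))) R2 1 ?R3"
    using runs_Store[of x "2 * d" "2 * (d + 1)" R2] a R2(2) by simp
  from runs_seq[OF R1(1) runs_seq[OF R2(1) this]]
  have "runs x (compile_pg (Put i u v p) d) R (poly (ptime (Put i u v p)) ?L) ?R3"
    by (simp add: add.assoc eval_nat_numeral)
  moreover have even: "?R3 (2 * j) = R2 (2 * j)" for j
    using address_neq(1) by (metis fun_upd_other)
  moreover have "R2 (2 * j) = R (2 * j)" if "j < d" for j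
    using same_get[OF same_trans[OF R1(3) R2(3)] that] by simp
  moreover have "stored ?L (psem x e (Put i u v p) \<rho>) ?R3"
    using st2 uv unfolding state_def stored_def by (auto dest: address_inj)
  then have "state N ?L e (psem x e (Put i u v p) \<rho>) ?R3"
    using st2 even unfolding state_def by presburger
  ultimately show ?case by metis
next
  case (For v p)
  let ?L = "length x"
  let ?\<rho> = "\<lambda>i. fold (\<lambda>a. psem x (e(v := a)) p) [0..<i] \<rho>"
  have v: "2 \<le> v" "v < d" "v < N" "2 \<le> d" using For.prems by auto
  define J where "J i S \<longleftrightarrow> stored ?L (?\<rho> i) S \<and> (\<forall>j<d. j \<noteq> v \<longrightarrow> S (2 * j) = R (2 * j))" for i S
  have J: "J 0 R" using For.prems by (simp add: J_def state_def)
  have body: "\<exists>S'. runs x (compile_pg p (d + 2)) S (poly (ptime p) ?L) S' \<and> J (Suc i) S' \<and>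
      (\<forall>j\<in>{1, v, d, d + 1}. S' (2 * j) = S (2 * j))"
    if i: "i < ?L" "J i S" "S (2 * v) = i" for i S
  proof -
    have st: "state N ?L (e(v := i)) (?\<rho> i) S"
      using For.prems i v admissible_upd[of N ?L e v i] unfolding state_def J_def by auto
    have "pg_ok N p" "N \<le> d + 2" using For.prems by auto
    from For.IH[OF st this] obtain S' where S': "runs x (compile_pg p (d + 2)) S (poly (ptime p) ?L) S'"
      "state N ?L (e(v := i)) (psem x (e(v := i)) p (?\<rho> i)) S'"
      "\<And>j. j < d + 2 \<Longrightarrow> S' (2 * j) = S (2 * j)"
      by blast
    have "J (Suc i) S'" using S'(2,3) i(2) unfolding J_def state_def by auto
    then show ?thesis
      using S'(1) S'(3)[of 1] S'(3)[of v] S'(3)[of d] S'(3)[of "d + 1"] v by auto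
  qed
  have frame: "J i S'" if "J i S" "\<And>a. a \<notin> {2 * v, 2 * d, 2 * (d + 1)} \<Longrightarrow> S' a = S a" for i S S'
  proof -
    have "S' (address ?L j a b) = S (address ?L j a b)" for j a b
      using that(2) address_neq(1) by blast
    moreover have "S' (2 * j) = S (2 * j)" if "j < d" "j \<noteq> v" for j
      using \<open>\<And>a. a \<notin> _ \<Longrightarrow> S' a = S a\<close>[of "2 * j"] that by simp
    ultimately show ?thesis using that(1) unfolding J_def stored_def by metis
  qed
  have "\<exists>S. runs x (for_loop v d (compile_pg p (d + 2))) R (?L * (poly (ptime p) ?L + 4) + 5) S \<and>
      J ?L S \<and> S (2 * v) = R (2 * v)"
  proof (rule runs_for_loop[where J = J and L = ?L])
    show "R 0 = ?L" "R 2 = 1" using state_regs[OF For.prems(1)] by simp_all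
  qed (fact v frame body J)+
  then obtain S where S: "runs x (for_loop v d (compile_pg p (d + 2))) R (?L * (poly (ptime p) ?L + 4) + 5) S"
    "J ?L S" "S (2 * v) = R (2 * v)" by blast
  have regs: "\<forall>j<d. S (2 * j) = R (2 * j)" using S(2,3) unfolding J_def by metis
  moreover have "state N ?L e (psem x e (For v p) \<rho>) S"
    using For.prems S(2) regs unfolding state_def J_def by auto
  moreover have "runs x (compile_pg (For v p) d) R (poly (ptime (For v p)) ?L) S"
    using S(1) by (simp add: algebra_simps)
  ultimately show ?case by blast
next
  case (Seq p q)
  obtain R1 where R1: "runs x (compile_pg p d) R (poly (ptime p) (length x)) R1"
    "state N (length x) e (psem x e p \<rho>) R1" "\<forall>j<d. R1 (2 * j) = R (2 * j)"
    using Seq.IH(1)[OF Seq.prems(1) _ Seq.prems(3)] Seq.prems(2) by auto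
  obtain R2 where R2: "runs x (compile_pg q d) R1 (poly (ptime q) (length x)) R2"
    "state N (length x) e (psem x e q (psem x e p \<rho>)) R2" "\<forall>j<d. R2 (2 * j) = R1 (2 * j)"
    using Seq.IH(2)[OF R1(2) _ Seq.prems(3)] Seq.prems(2) by auto
  show ?case using runs_seq[OF R1(1) R2(1)] R1(3) R2(2,3) by (intro exI[of _ R2]) auto
qed

definition compile :: "nat \<Rightarrow> pg \<Rightarrow> fm \<Rightarrow> ram_instr list" where
  "compile N p q =
     (instr (Const 2 1) ;; compile_pg p N ;; compile_fm q N ;; instr (Move 0 (2 * N))) 0"

text \<open>The initial zeros already store the empty relation in every table, so setting variable
  \<open>1\<close> is the only initialisation. Scratch space starts at variable
  \<open>N\<close>.\<close>

lemma compile_solves: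
  assumes ok: "2 \<le> N" "pg_ok N p" "fm_ok N q"
    and nonempty: "\<And>i. i \<in> I \<Longrightarrow> enc i \<noteq> []"
    and yes: "\<And>i e. i \<in> I \<Longrightarrow> admissible N (length (enc i)) e \<Longrightarrow>
      fsem (enc i) (psem (enc i) e p (\<lambda>_ _ _. False)) e q \<longleftrightarrow> yes i"
  shows "solvable_in_poly_time I enc yes"
  unfolding solvable_in_poly_time_def
proof (intro exI ballI)
  fix i assume i: "i \<in> I"
  let ?x = "enc i"
  let ?L = "length ?x"
  define e :: "nat \<Rightarrow> nat" where "e = (\<lambda>_. 0 :: nat)(0 := ?L, 1 := 1)"
  define R where "R = snd (ram_init ?x)"
  have R: "R = (\<lambda>_. 0)(0 := ?L)" by (simp add: R_def ram_init_def)
  have adm: "admissible N ?L e" using ok nonempty[OF i] by (simp add: admissible_def e_def)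
  let ?R1 = "R(2 := 1)"
  have R1: "runs ?x (instr (Const 2 1)) R 1 ?R1" by (rule runs_Const)
  have "state N ?L e (\<lambda>_ _ _. False) ?R1"
    using adm address_neq(1)[of ?L _ _ _ 1] unfolding state_def stored_def R
    by (auto simp: e_def address_neq)
  from runs_compile_pg[OF this ok(2) order_refl]
  obtain R2 where R2: "runs ?x (compile_pg p N) ?R1 (poly (ptime p) ?L) R2"
    "state N ?L e (psem ?x e p (\<lambda>_ _ _. False)) R2" by blast
  from runs_compile_fm[OF R2(2) ok(3) order_refl] yes[OF i adm]
  obtain R3 where R3: "runs ?x (compile_fm q N) R2 (poly (ftime q) ?L) R3" "R3 (2 * N) = of_bool (yes i)"
    by auto
  let ?B = "1 + (poly (ptime p) ?L + (poly (ftime q) ?L + 1))"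
  from runs_seq[OF R1 runs_seq[OF R2(1) runs_seq[OF R3(1) runs_Move[of ?x 0 "2 * N"]]]]
  obtain t where t: "t \<le> ?B"
    "(ram_step (compile N p q) ?x ^^ t) (0, R) = (length (compile N p q), R3(0 := of_bool (yes i)))"
    unfolding runs_def compile_def using R3(2)
    by (metis append_Nil append_Nil2 list.size(3) add_0)
  let ?c = "(length (compile N p q), R3(0 := of_bool (yes i)))"
  \<comment> \<open>A halted configuration is a fixed point, so the steps left up to the bound do no
    harm.\<close>
  have "(ram_step (compile N p q) ?x ^^ k) ?c = ?c" for k
    by (induction k) (simp_all add: ram_step_def ram_halted_def)
  then have "(ram_step (compile N p q) ?x ^^ (?B - t + t)) (0, R) = ?c"
    using t(2) by (simp only: funpow_add o_apply)
  moreover have "ram_init ?x = (0, R)" by (simp add: R_def ram_init_def)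
  ultimately show "ram_answers_within (compile N p q) ?x (poly (ptime p + ftime q + 2) ?L) (yes i)"
    using t(1) unfolding ram_answers_within_def by (simp add: ram_halted_def Let_def add.commute)
qed

section \<open>The greedy algorithm as a program\<close>

abbreviation conj_fm :: "fm \<Rightarrow> fm \<Rightarrow> fm" where
  "conj_fm p q \<equiv> Neg (Disj (Neg p) (Neg q))"

definition eq_fm :: "nat \<Rightarrow> nat \<Rightarrow> fm" where
  "eq_fm u v = Neg (Disj (Less (V u) (V v)) (Less (V v) (V u)))"

lemma fsem_eq_fm [simp]: "fsem x \<rho> e (eq_fm u v) \<longleftrightarrow> e u = e v"
  by (auto simp: eq_fm_def)

lemma fm_ok_eq_fm [simp]: "fm_ok N (eq_fm u v) \<longleftrightarrow> u < N \<and> v < N"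
  by (auto simp: eq_fm_def)

fun rels :: "fm \<Rightarrow> nat set" where
  "rels (Bit t) = {}"
| "rels (Less s t) = {}"
| "rels (Rel i u v) = {i}"
| "rels (Neg p) = rels p"
| "rels (Disj p q) = rels p \<union> rels q"
| "rels (Exists v p) = rels p"

lemma rels_eq_fm [simp]: "rels (eq_fm u v) = {}"
  by (simp add: eq_fm_def)

lemma fsem_cong: "(\<And>i. i \<in> rels p \<Longrightarrow> \<rho> i = \<rho>' i) \<Longrightarrow> fsem x \<rho> e p = fsem x \<rho>' e p"
  by (induction p arbitrary: e) auto

definition set_table :: "nat \<Rightarrow> fm \<Rightarrow> pg" where
  "set_table i p = For 2 (For 3 (Put i 2 3 p))"

lemma pg_ok_set_table [simp]: "pg_ok N (set_table i p) \<longleftrightarrow> 3 < N \<and> fm_ok N p"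
  by (auto simp: set_table_def)

lemma fold_upt_invariant:
  assumes "P 0 s" "\<And>k s. k < m \<Longrightarrow> P k s \<Longrightarrow> P (Suc k) (f k s)"
  shows "P m (fold f [0..<m] s)"
  using assms by (induction m) auto

text \<open>As \<open>p\<close> does not read table \<open>i\<close>, entries already overwritten
  cannot influence later ones, and the nested loops act as a simultaneous assignment. In the proof,
  \<open>?upd M\<close> is the state in which the entries in \<open>M\<close> have been
  overwritten.\<close>

lemma psem_set_table:
  assumes "i \<notin> rels p"
  shows "psem x e (set_table i p) \<rho> =
    \<rho>(i := \<lambda>a b. if a < length x \<and> b < length x then fsem x \<rho> (e(2 := a, 3 := b)) p else \<rho> i a b)"
proof -
  let ?L = "length x"
  let ?f = "\<lambda>a b. fsem x \<rho> (e(2 := a, 3 := b)) p"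
  let ?upd = "\<lambda>M. \<rho>(i := \<lambda>a b. if M a b then ?f a b else \<rho> i a b)"
  have f: "fsem x (?upd M) e' p = fsem x \<rho> e' p" for M e'
    by (rule fsem_cong) (use assms in auto)
  have put: "psem x (e(2 := a, 3 := b)) (Put i 2 3 p) (?upd M) = ?upd (\<lambda>a' b'. M a' b' \<or> a' = a \<and> b' = b)"
    for a b M
    by (rule ext)+ (simp add: f)
  have inner: "psem x (e(2 := a)) (For 3 (Put i 2 3 p)) (?upd M) = ?upd (\<lambda>a' b. M a' b \<or> a' = a \<and> b < ?L)"
    for a M
    unfolding psem.simps(2)
  proof (rule fold_upt_invariant[where P = "\<lambda>m r. r = ?upd (\<lambda>a' b. M a' b \<or> a' = a \<and> b < m)"])
    fix k r assume r: "r = ?upd (\<lambda>a' b. M a' b \<or> a' = a \<and> b < k)"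
    show "psem x (e(2 := a, 3 := k)) (Put i 2 3 p) r = ?upd (\<lambda>a' b. M a' b \<or> a' = a \<and> b < Suc k)"
      unfolding r put by (intro ext) (simp add: less_Suc_eq disj_assoc conj_disj_distribL)
  qed simp
  have "psem x e (set_table i p) \<rho> = ?upd (\<lambda>a b. a < ?L \<and> b < ?L)"
    unfolding set_table_def psem.simps(2)[of x e 2]
  proof (rule fold_upt_invariant[where P = "\<lambda>m r. r = ?upd (\<lambda>a b. a < m \<and> b < ?L)"])
    fix k r assume r: "r = ?upd (\<lambda>a b. a < k \<and> b < ?L)"
    show "psem x (e(2 := k)) (For 3 (Put i 2 3 p)) r = ?upd (\<lambda>a b. a < Suc k \<and> b < ?L)"
      unfolding r inner by (intro ext) (simp add: less_Suc_eq conj_disj_distribR)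
  qed simp
  then show ?thesis .
qed

section \<open>Reflexive transitive closure by repeated composition\<close>

definition holds :: "nat \<Rightarrow> tables \<Rightarrow> nat \<Rightarrow> nat rel \<Rightarrow> bool" where
  "holds L \<rho> i X \<longleftrightarrow> (\<forall>a<L. \<forall>b<L. \<rho> i a b \<longleftrightarrow> (a, b) \<in> X)"

text \<open>Table \<open>5\<close> is a buffer, as a formula must not read the table it is written to.\<close>

definition closure_pg :: "nat \<Rightarrow> nat \<Rightarrow> fm \<Rightarrow> pg" where
  "closure_pg v i q =
     Seq (set_table i (eq_fm 2 3))
       (For v (Seq (set_table 5 (Exists 4 (conj_fm (Rel i 2 4) (Disj (eq_fm 4 3) q))))
          (set_table i (Rel 5 2 3))))"

text \<open>The exponent is bounded by the number of arcs, and the reflexive part pads shorter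
  paths.\<close>

lemma reflcl_relpow_eq_rtrancl:
  assumes "finite Q" "card Q \<le> m"
  shows "(Q\<^sup>=) ^^ m = Q\<^sup>*"
proof
  show "(Q\<^sup>=) ^^ m \<subseteq> Q\<^sup>*"
    using relpow_imp_rtrancl[of _ m "Q\<^sup>="] by auto
  have "Q ^^ k \<subseteq> (Q\<^sup>=) ^^ n" if "k \<le> n" for k n
    using that
  proof (induction n arbitrary: k)
    case (Suc n)
    show ?case
    proof (cases k)
      case 0
      then show ?thesis using Suc.IH[of 0] by auto
    next
      case (Suc j)
      then show ?thesis using Suc.IH[of j] Suc.prems by auto
    qed
  qed simp
  then have "Q ^^ k \<subseteq> (Q\<^sup>=) ^^ m" if "k \<le> card Q" for k using assms(2) that by simp
  moreover have "Q\<^sup>* = (\<Union>k\<in>{k. k \<le> card Q}. Q ^^ k)" by (rule rtrancl_finite_eq_relpow[OF assms(1)])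
  ultimately show "Q\<^sup>* \<subseteq> (Q\<^sup>=) ^^ m" by auto
qed

text \<open>Each round composes table \<open>i\<close> with the reflexive closure of
  \<open>Q\<close>. The formula \<open>q\<close> has to be correct for all contents of table
  \<open>i\<close> and of the buffer, since these change during the loop.\<close>

lemma psem_closure_pg:
  assumes q: "\<And>\<rho>' e'. (\<And>j. j \<noteq> i \<Longrightarrow> j \<noteq> 5 \<Longrightarrow> \<rho>' j = \<rho> j) \<Longrightarrow> e' 4 < length x \<Longrightarrow> e' 3 < length x \<Longrightarrow>
      fsem x \<rho>' e' q \<longleftrightarrow> (e' 4, e' 3) \<in> Q"
    and Q: "Q \<subseteq> {..<length x} \<times> {..<length x}" "card Q \<le> length x" and i: "i \<noteq> 5" "5 \<notin> rels q"
  shows "(\<forall>j. j \<noteq> i \<longrightarrow> j \<noteq> 5 \<longrightarrow> psem x e (closure_pg v i q) \<rho> j = \<rho> j) \<and>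
         holds (length x) (psem x e (closure_pg v i q) \<rho>) i (Q\<^sup>*)"
proof -
  let ?L = "length x"
  define P where "P k \<rho>' \<longleftrightarrow> (\<forall>j. j \<noteq> i \<longrightarrow> j \<noteq> 5 \<longrightarrow> \<rho>' j = \<rho> j) \<and> holds ?L \<rho>' i ((Q\<^sup>=) ^^ k)" for k \<rho>'
  let ?step = "Exists 4 (conj_fm (Rel i 2 4) (Disj (eq_fm 4 3) q))"
  have init: "P 0 (psem x e (set_table i (eq_fm 2 3)) \<rho>)"
    by (simp add: P_def psem_set_table holds_def)
  have "P (Suc k) (psem x e' (Seq (set_table 5 ?step) (set_table i (Rel 5 2 3))) \<rho>')"
    if P: "P k \<rho>'" for k e' \<rho>'
  proof -
    have "fsem x \<rho>' (e'(2 := a, 3 := b)) ?step \<longleftrightarrow> (a, b) \<in> (Q\<^sup>=) ^^ Suc k"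
      if ab: "a < ?L" "b < ?L" for a b
    proof -
      have "fsem x \<rho>' (e'(2 := a, 3 := b)) ?step \<longleftrightarrow>
          (\<exists>z<?L. (a, z) \<in> (Q\<^sup>=) ^^ k \<and> (z = b \<or> (z, b) \<in> Q))"
        using P ab q[of \<rho>' "e'(2 := a, 3 := b, 4 := _)"] by (auto simp: P_def holds_def)
      \<comment> \<open>The bound on \<open>z\<close> is automatic: \<open>z\<close> is
        \<open>b\<close> or the tail of an arc of \<open>Q\<close>.\<close>
      also have "\<dots> \<longleftrightarrow> (\<exists>z. (a, z) \<in> (Q\<^sup>=) ^^ k \<and> (z = b \<or> (z, b) \<in> Q))"
        using Q(1) ab by auto
      finally show ?thesis by auto
    qed
    then show ?thesis
      using P i unfolding P_def holds_def by (simp add: psem_set_table del: relpow.simps)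
  qed
  then have "P ?L (psem x e (closure_pg v i q) \<rho>)"
    unfolding closure_pg_def psem.simps(2,3)
    by (intro fold_upt_invariant[where P = P, OF init]) (simp del: relpow.simps)
  moreover have "finite Q" using Q(1) finite_subset by blast
  ultimately show ?thesis unfolding P_def using reflcl_relpow_eq_rtrancl Q(2) by metis
qed

text \<open>This determines \<open>n\<close>, as the first zero of the encoding is the separator
  after \<open>n\<close> in unary.\<close>

definition size_fm :: "nat \<Rightarrow> fm" where
  "size_fm v = conj_fm (Neg (Bit (V v))) (Neg (Exists 11 (conj_fm (Less (V 11) (V v)) (Neg (Bit (V 11))))))"

text \<open>Bit \<open>n + 1 + (k * n + u) * n + v\<close> of the encoding is entry \<open>(u, v)\<close> of its \<open>k\<close>-th matrix.\<close>

definition entry_tm :: "tm \<Rightarrow> tm \<Rightarrow> tm \<Rightarrow> tm" where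
  "entry_tm k u v = Plus (Plus (V 10) (C 1)) (Plus (Times (Plus (Times k (V 10)) u) (V 10)) v)"

definition entry_fm :: "nat \<Rightarrow> fm" where
  "entry_fm k = Exists 10 (conj_fm (size_fm 10) (conj_fm (Less (V 2) (V 10)) (conj_fm (Less (V 3) (V 10))
     (Bit (entry_tm (C k) (V 2) (V 3))))))"

text \<open>Entry \<open>(0, 0)\<close> of a third matrix would be the first bit after the two
  matrices, which is the lowest bit of \<open>T\<close>. For \<open>T = 0\<close> the string ends
  before it, and the bit reads as false.\<close>

definition target_fm :: fm where
  "target_fm = Exists 10 (conj_fm (size_fm 10) (Bit (entry_tm (C 2) (C 0) (C 0))))"

definition conn_pg :: pg where
  "conn_pg = closure_pg 8 4
     (conj_fm (conj_fm (Rel 3 4 4) (Rel 3 3 3)) (Disj (Rel 1 4 3) (Rel 1 3 4)))"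

definition not_top_fm :: fm where
  "not_top_fm = Exists 4 (conj_fm (Rel 4 4 2) (Neg (Rel 2 4 2)))"

definition not_removable_fm :: fm where
  "not_removable_fm =
     Disj not_top_fm (Exists 4 (conj_fm (Rel 3 4 4) (conj_fm (Rel 1 2 4) (Neg (eq_fm 4 2)))))"

text \<open>
  Tables \<open>0\<close> and \<open>1\<close> hold the arcs and the commodities, table \<open>2\<close> reachability, the diagonal of table
  \<open>3\<close> the remaining vertices, and table \<open>4\<close> the components of the commodities among them. Variables
  range over all numbers below the input length; those that are not vertices are isolated and
  disappear in the first deletion.
\<close>

definition greedy_pg :: pg where
  "greedy_pg =
     Seq (set_table 0 (entry_fm 0)) (Seq (set_table 1 (entry_fm 1)) (Seq (closure_pg 8 2 (Rel 0 4 3))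
      (Seq (set_table 3 (eq_fm 2 2)) (Seq conn_pg (Seq (set_table 3 not_top_fm)
       (For 9 (Seq conn_pg (Seq (set_table 5 (conj_fm (Rel 3 2 2) not_removable_fm))
          (set_table 3 (Rel 5 2 3))))))))))"

definition answer_fm :: fm where
  "answer_fm =
     Disj
       (conj_fm target_fm (conj_fm (Neg (Exists 2 (Exists 3 (conj_fm (Rel 1 2 3) (Neg (Rel 2 2 3))))))
          (Neg (Exists 2 (Rel 3 2 2)))))
       (conj_fm (Neg target_fm) (Neg (Exists 2 (Exists 3 (conj_fm (Rel 1 2 3) (Neg (eq_fm 2 3)))))))"

section \<open>Correctness of the greedy program\<close>

definition alive :: "nat \<Rightarrow> tables \<Rightarrow> nat set" where
  "alive L \<rho> = {a. a < L \<and> \<rho> 3 a a}"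

text \<open>Symmetrising may double the number of arcs, hence the factor \<open>2\<close> in the
  bound.\<close>

lemma psem_conn_pg:
  assumes K: "holds (length x) \<rho> 1 K" "K \<subseteq> {..<length x} \<times> {..<length x}" "2 * card K \<le> length x"
  shows "(\<forall>j. j \<noteq> 4 \<longrightarrow> j \<noteq> 5 \<longrightarrow> psem x e conn_pg \<rho> j = \<rho> j) \<and>
         holds (length x) (psem x e conn_pg \<rho>) 4 (conn K (alive (length x) \<rho>))"
  unfolding conn_pg_def conn_def
proof (rule psem_closure_pg)
  let ?Q = "(K \<union> K\<inverse>) \<inter> alive (length x) \<rho> \<times> alive (length x) \<rho>"
  have fin: "finite K" using K(2) finite_subset by blast
  have "card ?Q \<le> card (K \<union> K\<inverse>)" using fin by (intro card_mono) auto
  also have "\<dots> \<le> card K + card (K\<inverse>)" by (rule card_Un_le)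
  finally show "card ?Q \<le> length x" using K(3) by (simp add: card_inverse)
  show "?Q \<subseteq> {..<length x} \<times> {..<length x}" using K(2) by auto
  show "fsem x \<rho>' e' (conj_fm (conj_fm (Rel 3 4 4) (Rel 3 3 3)) (Disj (Rel 1 4 3) (Rel 1 3 4))) \<longleftrightarrow>
      (e' 4, e' 3) \<in> ?Q"
    if "\<And>j. j \<noteq> 4 \<Longrightarrow> j \<noteq> 5 \<Longrightarrow> \<rho>' j = \<rho> j" "e' 4 < length x" "e' 3 < length x" for \<rho>' e'
    using that(2,3) K(1) by (auto simp: that(1) alive_def holds_def)
qed auto

lemma psem_greedy_pg:
  fixes x :: "bool list" and e :: "nat \<Rightarrow> nat" and \<rho> :: tables
  assumes E: "E \<subseteq> {..<length x} \<times> {..<length x}" "card E \<le> length x"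
    and K: "K \<subseteq> {..<length x} \<times> {..<length x}" "2 * card K \<le> length x"
    and entry: "\<And>\<rho> e. fsem x \<rho> e (entry_fm 0) \<longleftrightarrow> (e 2, e 3) \<in> E"
      "\<And>\<rho> e. fsem x \<rho> e (entry_fm 1) \<longleftrightarrow> (e 2, e 3) \<in> K"
  defines "\<rho>' \<equiv> psem x e greedy_pg \<rho>" and "U \<equiv> {..<length x}"
  shows "holds (length x) \<rho>' 1 K" "holds (length x) \<rho>' 2 (E\<^sup>*)"
    "alive (length x) \<rho>' = (prune (E\<^sup>*) K ^^ length x) (U - top_set (E\<^sup>*) K U)"
proof -
  let ?L = "length x"
  have rels01: "rels (entry_fm k) = {}" for k by (simp add: entry_fm_def size_fm_def)
  define \<rho>1 where "\<rho>1 = psem x e (set_table 1 (entry_fm 1)) (psem x e (set_table 0 (entry_fm 0)) \<rho>)"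
  have \<rho>1: "holds ?L \<rho>1 0 E" "holds ?L \<rho>1 1 K"
    by (auto simp: \<rho>1_def psem_set_table rels01 entry entry(2)[unfolded One_nat_def] holds_def)
  define \<rho>2 where "\<rho>2 = psem x e (closure_pg 8 2 (Rel 0 4 3)) \<rho>1"
  have "(\<forall>j. j \<noteq> 2 \<longrightarrow> j \<noteq> 5 \<longrightarrow> \<rho>2 j = \<rho>1 j) \<and> holds ?L \<rho>2 2 (E\<^sup>*)"
    unfolding \<rho>2_def
    by (rule psem_closure_pg) (use E \<rho>1 in \<open>auto simp: holds_def\<close>)
  then have \<rho>2: "holds ?L \<rho>2 1 K" "holds ?L \<rho>2 2 (E\<^sup>*)"
    using \<rho>1 by (auto simp: holds_def)
  define \<rho>3 where "\<rho>3 = psem x e (set_table 3 (eq_fm 2 2)) \<rho>2"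
  have \<rho>3: "holds ?L \<rho>3 1 K" "holds ?L \<rho>3 2 (E\<^sup>*)" "alive ?L \<rho>3 = U"
    using \<rho>2 by (auto simp: \<rho>3_def psem_set_table holds_def alive_def U_def)
  define \<rho>4 where "\<rho>4 = psem x e conn_pg \<rho>3"
  have \<rho>4: "holds ?L \<rho>4 1 K" "holds ?L \<rho>4 2 (E\<^sup>*)" "alive ?L \<rho>4 = U" "holds ?L \<rho>4 4 (conn K U)"
    using psem_conn_pg[OF \<rho>3(1) K, of e] \<rho>3 unfolding \<rho>4_def[symmetric] by (auto simp: holds_def alive_def)
  \<comment> \<open>Quantifiers in formulas stop at the input length. By this fact they agree with
    the unbounded one in \<open>top_set\<close>.\<close>
  have conn_U: "u < ?L" if "(u, a) \<in> conn K A" "a < ?L" for u a A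
    using that K(1) unfolding conn_def by (cases rule: converse_rtranclE) auto
  define \<rho>5 where "\<rho>5 = psem x e (set_table 3 not_top_fm) \<rho>4"
  have "alive ?L \<rho>5 = U - top_set (E\<^sup>*) K U"
    using \<rho>4 conn_U
    by (auto simp: \<rho>5_def psem_set_table not_top_fm_def alive_def holds_def top_set_def U_def)
  moreover have "holds ?L \<rho>5 1 K" "holds ?L \<rho>5 2 (E\<^sup>*)"
    using \<rho>4 by (auto simp: \<rho>5_def psem_set_table not_top_fm_def holds_def)
  \<comment> \<open>Table \<open>4\<close> is absent from the invariant because every round
    recomputes the components of what is left.\<close>
  moreover define P where "P k r \<longleftrightarrow> holds ?L r 1 K \<and> holds ?L r 2 (E\<^sup>*) \<and>
      alive ?L r = (prune (E\<^sup>*) K ^^ k) (U - top_set (E\<^sup>*) K U)" for k r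
  ultimately have P0: "P 0 \<rho>5" by simp
  have "P (Suc k) (psem x e' (Seq conn_pg (Seq (set_table 5 (conj_fm (Rel 3 2 2) not_removable_fm))
          (set_table 3 (Rel 5 2 3)))) r)" if P: "P k r" for k e' r
  proof -
    define r1 where "r1 = psem x e' conn_pg r"
    have r1: "holds ?L r1 1 K" "holds ?L r1 2 (E\<^sup>*)" "alive ?L r1 = alive ?L r"
      "holds ?L r1 4 (conn K (alive ?L r))"
      using psem_conn_pg[of x r K e'] P K unfolding P_def r1_def[symmetric]
      by (auto simp: holds_def alive_def)
    define r2 where "r2 = psem x e' (Seq (set_table 5 (conj_fm (Rel 3 2 2) not_removable_fm))
          (set_table 3 (Rel 5 2 3))) r1"
    have r2: "holds ?L r2 1 K" "holds ?L r2 2 (E\<^sup>*)"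
      using r1 by (auto simp: r2_def psem_set_table not_removable_fm_def not_top_fm_def holds_def)
    have al: "a \<in> alive ?L r \<longleftrightarrow> a < ?L \<and> r1 3 a a" for a
      using r1(3) by (auto simp: alive_def)
    have "a \<in> alive ?L r2 \<longleftrightarrow> a \<in> prune (E\<^sup>*) K (alive ?L r)" for a
    proof (cases "a < ?L")
      case True
      have "a \<in> alive ?L r2 \<longleftrightarrow> a \<in> alive ?L r \<and>
          ((\<exists>u<?L. (u, a) \<in> conn K (alive ?L r) \<and> (u, a) \<notin> E\<^sup>*) \<or>
           (\<exists>w<?L. w \<in> alive ?L r \<and> (a, w) \<in> K \<and> w \<noteq> a))"
      proof -
        have "a \<in> alive ?L r2 \<longleftrightarrow> fsem x r1 (e'(2 := a, 3 := a)) (conj_fm (Rel 3 2 2) not_removable_fm)"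
          using True by (simp add: alive_def r2_def psem_set_table not_removable_fm_def not_top_fm_def)
        also have "\<dots> \<longleftrightarrow> r1 3 a a \<and> ((\<exists>u<?L. r1 4 u a \<and> \<not> r1 2 u a) \<or>
            (\<exists>w<?L. r1 3 w w \<and> r1 1 a w \<and> w \<noteq> a))"
          by (auto simp: not_removable_fm_def not_top_fm_def)
        also have "r1 3 a a \<longleftrightarrow> a \<in> alive ?L r" using True by (simp add: al)
        also have "(\<exists>u<?L. r1 4 u a \<and> \<not> r1 2 u a) \<longleftrightarrow>
            (\<exists>u<?L. (u, a) \<in> conn K (alive ?L r) \<and> (u, a) \<notin> E\<^sup>*)"
          using r1(2,4) True unfolding holds_def by blast
        also have "(\<exists>w<?L. r1 3 w w \<and> r1 1 a w \<and> w \<noteq> a) \<longleftrightarrow>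
            (\<exists>w<?L. w \<in> alive ?L r \<and> (a, w) \<in> K \<and> w \<noteq> a)"
          using r1(1) al True unfolding holds_def by blast
        finally show ?thesis .
      qed
      also have "\<dots> \<longleftrightarrow> a \<in> prune (E\<^sup>*) K (alive ?L r)"
        using True conn_U K(1) unfolding prune_def removable_def top_set_def by blast
      finally show ?thesis .
    qed (auto simp: alive_def prune_def)
    then have "alive ?L r2 = prune (E\<^sup>*) K (alive ?L r)" by blast
    then have "P (Suc k) r2" using P r2 by (simp add: P_def)
    then show ?thesis by (simp only: r2_def r1_def psem.simps(3))
  qed
  then have "P ?L (fold (\<lambda>a. psem x (e(9 := a)) (Seq conn_pg
      (Seq (set_table 5 (conj_fm (Rel 3 2 2) not_removable_fm)) (set_table 3 (Rel 5 2 3)))))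
      [0..<?L] \<rho>5)"
    by (intro fold_upt_invariant[where P = P, OF P0])
  then have "P ?L \<rho>'"
    unfolding \<rho>'_def greedy_pg_def psem.simps(2,3) \<rho>5_def \<rho>4_def \<rho>3_def \<rho>2_def \<rho>1_def by simp
  then show "holds (length x) \<rho>' 1 K" "holds (length x) \<rho>' 2 (E\<^sup>*)"
    "alive (length x) \<rho>' = (prune (E\<^sup>*) K ^^ length x) (U - top_set (E\<^sup>*) K U)"
    by (auto simp: P_def)
qed

section \<open>Instances and their encoding\<close>

lemma apath_iff_rtrancl:
  assumes "wf_digraph (with_proj H)"
  shows "(\<exists>p. pre_digraph.apath (with_proj H) s p t) \<longleftrightarrow> s \<in> pverts H \<and> (s, t) \<in> (parcs H)\<^sup>*"
  using wf_digraph.reachable_apath[OF assms, of s t] wf_digraph.reachable_conv[OF assms, of s t]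
    wf_digraph.reachable_conv'[OF assms, of s t] by auto

text \<open>Isolated vertices do no harm, so \<open>H\<close> may be given all vertices of
  \<open>D\<close>, and only its arc set matters.\<close>

lemma md_rspp_iff:
  assumes D: "pair_fin_digraph D" and K: "K \<subseteq> pverts D \<times> pverts D"
  shows "md_rspp (D, T, K) \<longleftrightarrow>
    (\<exists>F. F \<subseteq> (parcs D)\<^sup>* \<inter> pverts D \<times> pverts D \<and> (\<forall>v. card {e \<in> F. fst e = v} \<le> T) \<and> K \<subseteq> F\<^sup>*)"
proof -
  interpret pair_fin_digraph D by fact
  have wfD: "wf_digraph (with_proj D)" by unfold_locales
  have closure: "parcs (transitive_closure D) = (parcs D)\<^sup>* \<inter> pverts D \<times> pverts D"
    using wf_digraph.reachable_apath[OF wfD] wf_digraph.reachable_conv[OF wfD]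
    by (auto simp: transitive_closure_def)
  have verts: "pverts (transitive_closure D) = pverts D" by (simp add: transitive_closure_def)
  show ?thesis
  proof
    assume "md_rspp (D, T, K)"
    then obtain H :: "'a pair_pre_digraph"
      where H: "subgraph (with_proj H) (with_proj (transitive_closure D))"
        "\<forall>v\<in>pverts H. out_degree (with_proj H) v \<le> T"
        "\<forall>(s, t)\<in>K. \<exists>p. pre_digraph.apath (with_proj H) s p t"
      unfolding md_rspp.simps by blast
    have wf: "wf_digraph (with_proj H)" using H(1) by (auto simp: subgraph_def)
    have "parcs H \<subseteq> (parcs D)\<^sup>* \<inter> pverts D \<times> pverts D"
      using H(1) closure by (auto simp: subgraph_def)
    moreover have "card {e \<in> parcs H. fst e = v} \<le> T" for v
    proof (cases "v \<in> pverts H")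
      case True
      then show ?thesis using H(2) by (simp add: out_degree_def out_arcs_def)
    next
      case False
      then have none: "{e \<in> parcs H. fst e = v} = {}" using wf_digraph.tail_in_verts[OF wf] by auto
      show ?thesis unfolding none by simp
    qed
    moreover have "K \<subseteq> (parcs H)\<^sup>*" using H(3) apath_iff_rtrancl[OF wf] by auto
    ultimately show "\<exists>F. F \<subseteq> (parcs D)\<^sup>* \<inter> pverts D \<times> pverts D \<and>
        (\<forall>v. card {e \<in> F. fst e = v} \<le> T) \<and> K \<subseteq> F\<^sup>*" by blast
  next
    assume "\<exists>F. F \<subseteq> (parcs D)\<^sup>* \<inter> pverts D \<times> pverts D \<and>
        (\<forall>v. card {e \<in> F. fst e = v} \<le> T) \<and> K \<subseteq> F\<^sup>*"
    then obtain F where F: "F \<subseteq> (parcs D)\<^sup>* \<inter> pverts D \<times> pverts D"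
      "\<And>v. card {e \<in> F. fst e = v} \<le> T" "K \<subseteq> F\<^sup>*" by blast
    let ?H = "\<lparr>pverts = pverts D, parcs = F\<rparr>"
    have wf: "wf_digraph (with_proj ?H)" using F(1) by unfold_locales auto
    have "wf_digraph (with_proj (transitive_closure D))"
      by unfold_locales (auto simp: closure verts)
    then have "subgraph (with_proj ?H) (with_proj (transitive_closure D))"
      using wf F(1) by (auto simp: subgraph_def compatible_def closure verts)
    moreover have "\<exists>p. pre_digraph.apath (with_proj ?H) s p t" if "(s, t) \<in> K" for s t
      using apath_iff_rtrancl[OF wf] that K F(3) by auto
    ultimately show "md_rspp (D, T, K)"
      using F(2) by (auto simp: out_degree_def out_arcs_def intro!: exI[of _ ?H])
  qed
qed

lemma md_rspp_0_iff:
  assumes D: "pair_fin_digraph D" and K: "K \<subseteq> pverts D \<times> pverts D"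
  shows "md_rspp (D, 0, K) \<longleftrightarrow> K \<subseteq> Id"
proof -
  interpret pair_fin_digraph D by fact
  have "F = {}" if "F \<subseteq> (parcs D)\<^sup>* \<inter> pverts D \<times> pverts D" "\<And>v. card {e \<in> F. fst e = v} \<le> 0" for F
  proof -
    \<comment> \<open>Finiteness matters here: an infinite set would have cardinality
      \<open>0\<close> too.\<close>
    have "finite F" using that(1) pair_finite_verts by (meson finite_Int finite_SigmaI finite_subset)
    then show ?thesis using that(2) by fastforce
  qed
  moreover have "\<forall>v. card {e \<in> {}. fst e = v} \<le> 0" by simp
  ultimately have "md_rspp (D, 0, K) \<longleftrightarrow> K \<subseteq> {}\<^sup>*"
    unfolding md_rspp_iff[OF assms] by (blast intro: empty_subsetI)
  then show ?thesis by simp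
qed

lemma md_rspp_1_iff:
  assumes D: "pair_fin_digraph D" and K: "K \<subseteq> pverts D \<times> pverts D"
  shows "md_rspp (D, 1, K) \<longleftrightarrow> (\<exists>F. single_valued F \<and> F \<subseteq> (parcs D)\<^sup>* \<and> K \<subseteq> F\<^sup>*)"
proof -
  interpret pair_fin_digraph D by fact
  let ?V = "pverts D"
  have sv: "single_valued F \<longleftrightarrow> (\<forall>v. card {e \<in> F. fst e = v} \<le> 1)" if "F \<subseteq> ?V \<times> ?V" for F
  proof -
    have fin: "finite F" using that pair_finite_verts by (meson finite_SigmaI finite_subset)
    have "single_valued F \<longleftrightarrow> (\<forall>v. \<forall>e\<in>{e \<in> F. fst e = v}. \<forall>e'\<in>{e \<in> F. fst e = v}. e = e')"
      by (auto simp: single_valued_def)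
    then show ?thesis using fin by (simp add: card_le_Suc0_iff_eq)
  qed
  \<comment> \<open>The reflexive closure has loops on the whole type. An arc of \<open>F\<close>
    that is not between vertices of \<open>D\<close> is such a loop, so dropping it loses no
    path.\<close>
  have restrict: "F\<^sup>* \<subseteq> (F \<inter> ?V \<times> ?V)\<^sup>*" if "F \<subseteq> (parcs D)\<^sup>*" for F
  proof -
    have "parcs D \<subseteq> ?V \<times> ?V" using in_arcsD1 in_arcsD2 by auto
    then have "(parcs D)\<^sup>+ \<subseteq> ?V \<times> ?V" by (rule trancl_subset_Sigma)
    moreover have "a = b \<or> (a, b) \<in> (parcs D)\<^sup>+" if "(a, b) \<in> F" for a b
      using that \<open>F \<subseteq> _\<close> by (auto simp: rtrancl_eq_or_trancl)
    ultimately have "(a, b) \<in> F \<inter> ?V \<times> ?V \<or> a = b" if "(a, b) \<in> F" for a b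
      using that by blast
    then have "F \<subseteq> (F \<inter> ?V \<times> ?V)\<^sup>*" by (intro subrelI) blast
    then show ?thesis by (metis rtrancl_mono rtrancl_idemp)
  qed
  show ?thesis unfolding md_rspp_iff[OF assms]
  proof
    assume "\<exists>F. F \<subseteq> (parcs D)\<^sup>* \<inter> ?V \<times> ?V \<and> (\<forall>v. card {e \<in> F. fst e = v} \<le> 1) \<and> K \<subseteq> F\<^sup>*"
    then show "\<exists>F. single_valued F \<and> F \<subseteq> (parcs D)\<^sup>* \<and> K \<subseteq> F\<^sup>*" using sv by auto
  next
    assume "\<exists>F. single_valued F \<and> F \<subseteq> (parcs D)\<^sup>* \<and> K \<subseteq> F\<^sup>*"
    then obtain F where F: "single_valued F" "F \<subseteq> (parcs D)\<^sup>*" "K \<subseteq> F\<^sup>*" by blast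
    have "single_valued (F \<inter> ?V \<times> ?V)" using F(1) by (auto simp: single_valued_def)
    then have "\<forall>v. card {e \<in> F \<inter> ?V \<times> ?V. fst e = v} \<le> 1" using sv[of "F \<inter> ?V \<times> ?V"] by blast
    moreover have "F \<inter> ?V \<times> ?V \<subseteq> (parcs D)\<^sup>* \<inter> ?V \<times> ?V" using F(2) by blast
    moreover have "K \<subseteq> (F \<inter> ?V \<times> ?V)\<^sup>*" using F(3) restrict[OF F(2)] by blast
    ultimately show "\<exists>F. F \<subseteq> (parcs D)\<^sup>* \<inter> ?V \<times> ?V \<and> (\<forall>v. card {e \<in> F. fst e = v} \<le> 1) \<and> K \<subseteq> F\<^sup>*"
      by blast
  qed
qed

section \<open>Reading the encoding\<close>

lemma length_adjacency_bits [simp]: "length (adjacency_bits n R) = n * n"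
  by (simp add: adjacency_bits_def)

lemma adjacency_index: "a < n \<Longrightarrow> b < n \<Longrightarrow> a * n + b < n * (n :: nat)"
proof -
  assume "a < n" "b < n"
  then have "a * n + b < Suc a * n" "Suc a * n \<le> n * n" by (simp, intro mult_le_mono1) simp
  then show "a * n + b < n * n" by linarith
qed

lemma adjacency_bits_nth:
  assumes "a < n" "b < n"
  shows "adjacency_bits n R ! (a * n + b) \<longleftrightarrow> (a, b) \<in> R"
  using assms adjacency_index[OF assms] by (simp add: adjacency_bits_def product_nth)

lemma fsem_size_fm:
  assumes "n < length x" "\<And>m. m < n \<Longrightarrow> x ! m" "\<not> x ! n"
  shows "fsem x \<rho> e (size_fm 10) \<longleftrightarrow> e 10 = n"
proof
  assume "fsem x \<rho> e (size_fm 10)"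
  then have "\<not> (e 10 < length x \<and> x ! e 10)" "\<And>m. m < length x \<Longrightarrow> m < e 10 \<Longrightarrow> x ! m"
    by (auto simp: size_fm_def)
  then show "e 10 = n" using assms by (metis less_trans linorder_neqE_nat)
qed (use assms in \<open>auto simp: size_fm_def\<close>)

lemma encoding:
  fixes D :: "nat pair_pre_digraph" and e :: "nat \<Rightarrow> nat"
  assumes V: "pverts D = {..<n}" and "T \<le> 1"
    and E: "parcs D \<subseteq> {..<n} \<times> {..<n}" and K: "K \<subseteq> {..<n} \<times> {..<n}"
  defines "x \<equiv> encode_md_rspp (D, T, K)"
  shows "n + 1 + 2 * (n * n) \<le> length x"
    and "fsem x \<rho> e (entry_fm 0) \<longleftrightarrow> (e 2, e 3) \<in> parcs D"
    and "fsem x \<rho> e (entry_fm 1) \<longleftrightarrow> (e 2, e 3) \<in> K"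
    and "fsem x \<rho> e target_fm \<longleftrightarrow> T = 1"
proof -
  let ?tail = "adjacency_bits n (parcs D) @ adjacency_bits n K @ binary T"
  have x: "x = replicate n True @ False # ?tail"
    by (simp add: x_def V Let_def)
  show len: "n + 1 + 2 * (n * n) \<le> length x" by (simp add: x)
  have n: "n < length x" using len by simp
  have size: "fsem x \<rho> e (size_fm 10) \<longleftrightarrow> e 10 = n" for e
    by (rule fsem_size_fm) (use n in \<open>auto simp: x nth_append\<close>)
  have tail: "x ! (n + 1 + j) = ?tail ! j" for j
    by (simp add: x nth_append)
  have entry: "fsem x \<rho> e (entry_fm k) \<longleftrightarrow> (e 2, e 3) \<in> R"
    if R: "R \<subseteq> {..<n} \<times> {..<n}" and bits: "k < 2"
      "\<And>j. j < n * n \<Longrightarrow> ?tail ! (k * (n * n) + j) = adjacency_bits n R ! j" for k R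
  proof -
    let ?i = "n + 1 + ((k * n + e 2) * n + e 3)"
    have "fsem x \<rho> e (entry_fm k) \<longleftrightarrow> e 2 < n \<and> e 3 < n \<and> ?i < length x \<and> x ! ?i"
      using n by (auto simp: entry_fm_def size entry_tm_def)
    also have "\<dots> \<longleftrightarrow> (e 2, e 3) \<in> R"
    proof (cases "e 2 < n \<and> e 3 < n")
      case True
      then have j: "e 2 * n + e 3 < n * n" using adjacency_index by blast
      have i: "?i = n + 1 + (k * (n * n) + (e 2 * n + e 3))" by (simp add: algebra_simps)
      have "k * (n * n) \<le> n * n" using bits(1) by (cases k) auto
      then have "?i < length x" unfolding i using j len by linarith
      moreover have "x ! ?i \<longleftrightarrow> (e 2, e 3) \<in> R"
        unfolding i tail bits(2)[OF j] using True by (simp add: adjacency_bits_nth)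
      ultimately show ?thesis using True by simp
    qed (use R in auto)
    finally show ?thesis .
  qed
  show "fsem x \<rho> e (entry_fm 0) \<longleftrightarrow> (e 2, e 3) \<in> parcs D"
    by (rule entry[OF E]) (auto simp: nth_append)
  show "fsem x \<rho> e (entry_fm 1) \<longleftrightarrow> (e 2, e 3) \<in> K"
    by (rule entry[OF K]) (auto simp: nth_append)
  let ?i = "n + 1 + 2 * (n * n)"
  have "fsem x \<rho> e target_fm \<longleftrightarrow> ?i < length x \<and> x ! ?i"
    using n by (auto simp: target_fm_def size entry_tm_def algebra_simps)
  also have "\<dots> \<longleftrightarrow> T = 1"
  proof -
    have "binary 0 = []" "binary 1 = [True]" by (simp_all add: binary.simps)
    moreover have "T = 0 \<or> T = 1" using \<open>T \<le> 1\<close> by linarith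
    ultimately show ?thesis unfolding tail by (auto simp: x nth_append)
  qed
  finally show "fsem x \<rho> e target_fm \<longleftrightarrow> T = 1" .
qed

theorem theorem2:
  shows "solvable_in_poly_time
           {i :: nat md_rspp. md_rspp_instance i \<and> numbered i \<and> target i \<le> 1}
           encode_md_rspp md_rspp"
proof (rule compile_solves)
  \<comment> \<open>The largest variable in use is \<open>11\<close>, in
    \<open>size_fm\<close>.\<close>
  show "2 \<le> (12 :: nat)" by simp
  show "pg_ok 12 greedy_pg"
    by (simp add: greedy_pg_def closure_pg_def conn_pg_def entry_fm_def size_fm_def entry_tm_def
        not_top_fm_def not_removable_fm_def)
  show "fm_ok 12 answer_fm"
    by (simp add: answer_fm_def target_fm_def size_fm_def entry_tm_def)
  fix i :: "nat md_rspp"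
  assume "i \<in> {i. md_rspp_instance i \<and> numbered i \<and> target i \<le> 1}"
  moreover obtain D T K where i: "i = (D, T, K)" by (cases i)
  ultimately have D: "pair_fin_digraph D" and KV: "K \<subseteq> pverts D \<times> pverts D" and T: "T \<le> 1"
    and "numbered i" by auto
  then obtain n where V: "pverts D = {..<n}" by (auto simp: numbered_def i)
  interpret pair_fin_digraph D by fact
  have E: "parcs D \<subseteq> {..<n} \<times> {..<n}" and K: "K \<subseteq> {..<n} \<times> {..<n}"
    using in_arcsD1 in_arcsD2 KV V by auto
  let ?x = "encode_md_rspp i"
  let ?L = "length ?x"
  note enc = encoding[OF V T E K, folded i]
  have "card (parcs D) \<le> n * n" "card K \<le> n * n"
    using card_mono[OF _ E] card_mono[OF _ K] by (simp_all add: card_cartesian_product)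
  then have card: "card (parcs D) \<le> ?L" "2 * card K \<le> ?L" using enc(1) by linarith+
  show "?x \<noteq> []" using enc(1) by auto
  fix e :: "nat \<Rightarrow> nat"
  define \<rho> where "\<rho> = psem ?x e greedy_pg (\<lambda>_ _ _. False)"
  have "n \<le> ?L" using enc(1) by linarith
  then have sub: "parcs D \<subseteq> {..<?L} \<times> {..<?L}" "K \<subseteq> {..<?L} \<times> {..<?L}" using E K by auto
  note greedy = psem_greedy_pg[OF sub(1) card(1) sub(2) card(2) enc(2,3),
      where e = e and \<rho> = "\<lambda>_ _ _. False", folded \<rho>_def]
  let ?R = "(parcs D)\<^sup>*"
  let ?U = "{..<?L}"
  have inK: "a < ?L \<and> b < ?L" if "(a, b) \<in> K" for a b using sub(2) that by auto
  have in1: "\<rho> 1 a b \<longleftrightarrow> (a, b) \<in> K" "\<rho> 2 a b \<longleftrightarrow> (a, b) \<in> ?R" if "a < ?L" "b < ?L" for a b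
    using greedy(1,2) that by (simp_all add: holds_def)
  have K_holds: "(\<forall>a<?L. \<forall>b<?L. \<rho> 1 a b \<longrightarrow> P a b) \<longleftrightarrow> (\<forall>(a, b)\<in>K. P a b)" for P
    using inK in1 by (auto simp: Ball_def)
  have "fsem ?x \<rho> e answer_fm \<longleftrightarrow>
      (T = 1 \<and> (\<forall>a<?L. \<forall>b<?L. \<rho> 1 a b \<longrightarrow> \<rho> 2 a b) \<and> alive ?L \<rho> = {}) \<or>
      (T \<noteq> 1 \<and> (\<forall>a<?L. \<forall>b<?L. \<rho> 1 a b \<longrightarrow> a = b))"
    by (auto simp: answer_fm_def enc(4) alive_def)
  also have "(\<forall>a<?L. \<forall>b<?L. \<rho> 1 a b \<longrightarrow> \<rho> 2 a b) \<longleftrightarrow> K \<subseteq> ?R"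
    using inK in1(2) unfolding K_holds by auto
  also have "(\<forall>a<?L. \<forall>b<?L. \<rho> 1 a b \<longrightarrow> a = b) \<longleftrightarrow> K \<subseteq> Id"
    unfolding K_holds by auto
  also have "(T = 1 \<and> K \<subseteq> ?R \<and> alive ?L \<rho> = {}) \<or> (T \<noteq> 1 \<and> K \<subseteq> Id) \<longleftrightarrow> md_rspp i"
  proof (cases "T = 1")
    case True
    have "md_rspp i \<longleftrightarrow> (\<exists>F. single_valued F \<and> F \<subseteq> ?R \<and> K \<subseteq> F\<^sup>*)"
      unfolding i True by (rule md_rspp_1_iff[OF D KV])
    also have "\<dots> \<longleftrightarrow> K \<subseteq> ?R \<and> (prune ?R K ^^ ?L) (?U - top_set ?R K ?U) = {}"
      \<comment> \<open>The numbers in \<open>?U\<close> that are not vertices form components of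
        their own and reach themselves, so \<open>top_set\<close> takes them out.\<close>
      by (rule routing_iff_prune) (use sub in \<open>auto simp: refl_rtrancl trans_rtrancl\<close>)
    finally show ?thesis using True greedy(3) by simp
  next
    case False
    then have "T = 0" using T by linarith
    then show ?thesis using md_rspp_0_iff[OF D KV] i by simp
  qed
  finally show "fsem ?x (psem ?x e greedy_pg (\<lambda>_ _ _. False)) e answer_fm \<longleftrightarrow> md_rspp i"
    by (simp add: \<rho>_def)
qed

end
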